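(* Let $({}_{f_2}M_1\times_{f_1}M_2,F)$ be a proper doubly warped product Finsler manifold (i.e. neither $f_1$ nor $f_2$ is constant). If the Douglas curvature of $F$ vanishes, then $({}_{f_2}M_1\times_{f_1}M_2,F)$ is a Riemannian manifold.
   Context: A Finsler metric on a smooth $n$-manifold $N$ is a function $F:TN\to[0,\infty)$ that is $C^\infty$ off the zero section, positively 1-homogeneous on fibers, and whose fundamental tensor $g_{ij}=\frac12\frac{\partial^2F^2}{\partial y^i\partial y^j}$ is positive definite at every nonzero $y$, where $(x^i,y^i)$ are standard coordinates on $TN$. $(g^{ij})$ is the inverse matrix of $(g_{ij})$. Doubly warped product (DWP): given Finsler manifolds $(M_1,F_1)$, $(M_2,F_2)$ and smooth functions $f_1:M_1\to\mathbb{R}^+$, $f_2:M_2\to\mathbb{R}^+$, the DWP-Finsler manifold $({}_{f_2}M_1\times_{f_1}M_2,F)$ is $M_1\times M_2$ with $F(v_1,v_2)=\sqrt{f_2^2(\pi_2(v_2))F_1^2(v_1)+f_1^2(\pi_1(v_1))F_2^2(v_2)}$, where $\pi_1,\pi_2$ denote the base points in $M_1,M_2$. $F$ is considered on $TM_1^\circ\times TM_2^\circ$, where $TM_i^\circ=TM_i\setminus\{0\}$, and all tensors of $F$ are taken there. The DWP is proper if neither $f_1$ nor $f_2$ is constant. Curvatures, for an $n$-dimensional Finsler manifold: the spray coefficients are $G^i=\frac14g^{il}\{\frac{\partial^2F^2}{\partial x^k\partial y^l}y^k-\frac{\partial F^2}{\partial x^l}\}$; the Berwald curvature is $B^i_{\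 jkl}=\frac{\partial^3G^i}{\partial y^j\partial y^k\partial y^l}$; the mean Berwald curvature is $E_{jk}=\frac12B^m_{\ jkm}$; the Douglas curvature is $D^i_{\ jkl}=B^i_{\ jkl}-\frac{2}{n+1}\{E_{jk}\delta^i_l+E_{jl}\delta^i_k+E_{kl}\delta^i_j+\frac{\partial E_{jk}}{\partial y^l}y^i\}$. A Finsler metric is Riemannian iff its Cartan torsion $C_{ijk}=\frac12\frac{\partial g_{ij}}{\partial y^k}$ vanishes.
   Formalization: The manifolds M_1 and M_2 are assumed connected; otherwise the claim fails, e.g. for f_1, f_2 nonconstant but constant on each component and F_1, F_2 non-Euclidean Minkowski norms, where the Douglas curvature vanishes. *)

theory Defs
  imports "HOL-Analysis.Analysis"
begin

section \<open>Smooth maps between open subsets of normed spaces\<close>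

text \<open>Only meaningful on open sets, where the Frechet derivative is unique.\<close>

fun ck_on :: "nat \<Rightarrow> 'a::real_normed_vector set \<Rightarrow> ('a \<Rightarrow> 'b::real_normed_vector) \<Rightarrow> bool" where
  "ck_on 0 S f \<longleftrightarrow> continuous_on S f"
| "ck_on (Suc k) S f \<longleftrightarrow> (\<forall>x\<in>S. f differentiable (at x)) \<and>
     (\<forall>v. ck_on k S (\<lambda>x. frechet_derivative f (at x) v))"

definition smooth_on :: "'a::real_normed_vector set \<Rightarrow> ('a \<Rightarrow> 'b::real_normed_vector) \<Rightarrow> bool" where
  "smooth_on S f \<longleftrightarrow> (\<forall>k. ck_on k S f)"

section \<open>Smooth manifolds\<close>

text \<open>A chart is a pair of its domain and its coordinate map. The dimension of the manifold is
  \<open>CARD('n)\<close>. The atlas is not required to be maximal.\<close>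

type_synonym ('a, 'n) chart = "'a set \<times> ('a \<Rightarrow> real ^ 'n)"

record ('a, 'n) manifold =
  mtop :: "'a topology"
  atlas :: "('a, 'n::finite) chart set"

abbreviation chart_inv :: "('a, 'n::finite) chart \<Rightarrow> real ^ 'n \<Rightarrow> 'a" where
  "chart_inv c \<equiv> inv_into (fst c) (snd c)"

definition smooth_manifold :: "('a, 'n::finite) manifold \<Rightarrow> bool" where
  "smooth_manifold M \<longleftrightarrow>
     Hausdorff_space (mtop M) \<and> second_countable (mtop M) \<and>
     \<Union> (fst ` atlas M) = topspace (mtop M) \<and>
     (\<forall>c\<in>atlas M. openin (mtop M) (fst c) \<and> open (snd c ` fst c) \<and>
        homeomorphic_map (subtopology (mtop M) (fst c)) (top_of_set (snd c ` fst c)) (snd c)) \<and>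
     (\<forall>c\<in>atlas M. \<forall>d\<in>atlas M. smooth_on (snd c ` (fst c \<inter> fst d)) (snd d \<circ> chart_inv c))"

definition smooth_function :: "('a, 'n::finite) manifold \<Rightarrow> ('a \<Rightarrow> real) \<Rightarrow> bool" where
  "smooth_function M f \<longleftrightarrow> (\<forall>c\<in>atlas M. smooth_on (snd c ` fst c) (f \<circ> chart_inv c))"

text \<open>The coordinates on a product manifold are indexed by the disjoint sum \<open>'n + 'm\<close>.\<close>

definition prod_chart ::
  "('a, 'n::finite) chart \<Rightarrow> ('b, 'm::finite) chart \<Rightarrow> ('a \<times> 'b, 'n + 'm) chart" where
  "prod_chart c d = (fst c \<times> fst d,
     \<lambda>(p, q). \<chi> k. case k of Inl i \<Rightarrow> snd c p $ i | Inr a \<Rightarrow> snd d q $ a)"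

definition prod_manifold ::
  "('a, 'n::finite) manifold \<Rightarrow> ('b, 'm::finite) manifold \<Rightarrow> ('a \<times> 'b, 'n + 'm) manifold" where
  "prod_manifold M N = \<lparr>mtop = prod_topology (mtop M) (mtop N),
     atlas = {prod_chart c d |c d. c \<in> atlas M \<and> d \<in> atlas N}\<rparr>"

section \<open>The tangent bundle\<close>

text \<open>A tangent vector at a point is the family of its component vectors in all charts around that
  point, related by the Jacobians of the coordinate changes. The value is 0 at all other charts, so
  that equal tangent vectors are represented by equal functions.\<close>

type_synonym ('a, 'n) tvec = "'a \<times> (('a, 'n) chart \<Rightarrow> real ^ 'n)"

definition tangent_space ::
  "('a, 'n::finite) manifold \<Rightarrow> 'a \<Rightarrow> (('a, 'n) chart \<Rightarrow> real ^ 'n) set" where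
  "tangent_space M p = {\<xi>.
     (\<forall>c. \<not> (c \<in> atlas M \<and> p \<in> fst c) \<longrightarrow> \<xi> c = 0) \<and>
     (\<forall>c\<in>atlas M. \<forall>d\<in>atlas M. p \<in> fst c \<longrightarrow> p \<in> fst d \<longrightarrow>
        \<xi> d = frechet_derivative (snd d \<circ> chart_inv c) (at (snd c p)) (\<xi> c))}"

definition tangent_bundle :: "('a, 'n::finite) manifold \<Rightarrow> ('a, 'n) tvec set" where
  "tangent_bundle M = Sigma (topspace (mtop M)) (tangent_space M)"

definition slit_tangent_bundle :: "('a, 'n::finite) manifold \<Rightarrow> ('a, 'n) tvec set" where
  "slit_tangent_bundle M = {v \<in> tangent_bundle M. snd v \<noteq> (\<lambda>c. 0)}"

definition tscale :: "real \<Rightarrow> ('a, 'n::finite) tvec \<Rightarrow> ('a, 'n) tvec" where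
  "tscale t v = (fst v, \<lambda>c. t *\<^sub>R snd v c)"

text \<open>The standard coordinates \<open>(x, y)\<close> on the tangent bundle over the domain of a chart.\<close>

definition tangent_chart :: "('a, 'n::finite) chart \<Rightarrow> ('a, 'n) tvec \<Rightarrow> (real ^ 'n) \<times> (real ^ 'n)" where
  "tangent_chart c v = (snd c (fst v), snd v c)"

definition local_rep ::
  "('a, 'n::finite) manifold \<Rightarrow> (('a, 'n) tvec \<Rightarrow> real) \<Rightarrow> ('a, 'n) chart
     \<Rightarrow> real ^ 'n \<Rightarrow> real ^ 'n \<Rightarrow> real" where
  "local_rep M F c x y =
     F (inv_into {v \<in> tangent_bundle M. fst v \<in> fst c} (tangent_chart c) (x, y))"

text \<open>For a smooth map \<open>f\<close> from \<open>M\<close> to \<open>N\<close>, the differential does not depend on the chart chosen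
  around the base point.\<close>

definition tangent_map ::
  "('a, 'n::finite) manifold \<Rightarrow> ('b, 'm::finite) manifold \<Rightarrow> ('a \<Rightarrow> 'b)
     \<Rightarrow> ('a, 'n) tvec \<Rightarrow> ('b, 'm) tvec" where
  "tangent_map M N f v =
     (let p = fst v; c = (SOME c. c \<in> atlas M \<and> p \<in> fst c) in
       (f p, \<lambda>d. if d \<in> atlas N \<and> f p \<in> fst d
                  then frechet_derivative (snd d \<circ> f \<circ> chart_inv c) (at (snd c p)) (snd v c)
                  else 0))"

section \<open>Tensors in standard coordinates\<close>

definition dx :: "'n \<Rightarrow> (real ^ 'n \<Rightarrow> real ^ 'n \<Rightarrow> real) \<Rightarrow> real ^ 'n \<Rightarrow> real ^ 'n::finite \<Rightarrow> real" where
  "dx i L x y = deriv (\<lambda>t. L (x + t *\<^sub>R axis i 1) y) 0"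

definition dy :: "'n \<Rightarrow> (real ^ 'n \<Rightarrow> real ^ 'n \<Rightarrow> real) \<Rightarrow> real ^ 'n \<Rightarrow> real ^ 'n::finite \<Rightarrow> real" where
  "dy i L x y = deriv (\<lambda>t. L x (y + t *\<^sub>R axis i 1)) 0"

text \<open>Below, \<open>L\<close> is the coordinate expression of a Finsler metric.\<close>

definition fund_tensor ::
  "(real ^ 'n \<Rightarrow> real ^ 'n \<Rightarrow> real) \<Rightarrow> 'n \<Rightarrow> 'n \<Rightarrow> real ^ 'n \<Rightarrow> real ^ 'n::finite \<Rightarrow> real" where
  "fund_tensor L i j x y = 1/2 * dy i (dy j (\<lambda>x y. (L x y)\<^sup>2)) x y"

definition fund_inverse ::
  "(real ^ 'n \<Rightarrow> real ^ 'n \<Rightarrow> real) \<Rightarrow> 'n \<Rightarrow> 'n \<Rightarrow> real ^ 'n \<Rightarrow> real ^ 'n::finite \<Rightarrow> real" where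
  "fund_inverse L i j x y = matrix_inv (\<chi> k l. fund_tensor L k l x y) $ i $ j"

definition cartan_torsion ::
  "(real ^ 'n \<Rightarrow> real ^ 'n \<Rightarrow> real) \<Rightarrow> 'n \<Rightarrow> 'n \<Rightarrow> 'n \<Rightarrow> real ^ 'n \<Rightarrow> real ^ 'n::finite \<Rightarrow> real" where
  "cartan_torsion L i j k x y = 1/2 * dy k (fund_tensor L i j) x y"

definition spray_coeff ::
  "(real ^ 'n \<Rightarrow> real ^ 'n \<Rightarrow> real) \<Rightarrow> 'n \<Rightarrow> real ^ 'n \<Rightarrow> real ^ 'n::finite \<Rightarrow> real" where
  "spray_coeff L i x y = 1/4 * (\<Sum>l\<in>UNIV. fund_inverse L i l x y *
     ((\<Sum>k\<in>UNIV. dx k (dy l (\<lambda>x y. (L x y)\<^sup>2)) x y * y $ k) - dx l (\<lambda>x y. (L x y)\<^sup>2) x y))"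

definition berwald ::
  "(real ^ 'n \<Rightarrow> real ^ 'n \<Rightarrow> real) \<Rightarrow> 'n \<Rightarrow> 'n \<Rightarrow> 'n \<Rightarrow> 'n \<Rightarrow> real ^ 'n \<Rightarrow> real ^ 'n::finite \<Rightarrow> real" where
  "berwald L i j k l x y = dy j (dy k (dy l (spray_coeff L i))) x y"

definition mean_berwald ::
  "(real ^ 'n \<Rightarrow> real ^ 'n \<Rightarrow> real) \<Rightarrow> 'n \<Rightarrow> 'n \<Rightarrow> real ^ 'n \<Rightarrow> real ^ 'n::finite \<Rightarrow> real" where
  "mean_berwald L j k x y = 1/2 * (\<Sum>m\<in>UNIV. berwald L m j k m x y)"

definition kronecker :: "'n \<Rightarrow> 'n \<Rightarrow> real" where
  "kronecker i j = (if i = j then 1 else 0)"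

definition douglas ::
  "(real ^ 'n \<Rightarrow> real ^ 'n \<Rightarrow> real) \<Rightarrow> 'n \<Rightarrow> 'n \<Rightarrow> 'n \<Rightarrow> 'n \<Rightarrow> real ^ 'n \<Rightarrow> real ^ 'n::finite \<Rightarrow> real" where
  "douglas L i j k l x y = berwald L i j k l x y - 2 / (real CARD('n) + 1) *
     (mean_berwald L j k x y * kronecker i l + mean_berwald L j l x y * kronecker i k +
      mean_berwald L k l x y * kronecker i j + dy l (mean_berwald L j k) x y * y $ i)"

section \<open>Finsler metrics\<close>

definition finsler_metric :: "('a, 'n::finite) manifold \<Rightarrow> (('a, 'n) tvec \<Rightarrow> real) \<Rightarrow> bool" where
  "finsler_metric M F \<longleftrightarrow>
     (\<forall>v\<in>tangent_bundle M. F v \<ge> 0) \<and>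
     (\<forall>c\<in>atlas M. smooth_on ((snd c ` fst c) \<times> (UNIV - {0})) (\<lambda>(x, y). local_rep M F c x y)) \<and>
     (\<forall>v\<in>tangent_bundle M. \<forall>t>0. F (tscale t v) = t * F v) \<and>
     (\<forall>c\<in>atlas M. \<forall>x\<in>snd c ` fst c. \<forall>y. y \<noteq> 0 \<longrightarrow> (\<forall>w. w \<noteq> 0 \<longrightarrow>
        (\<Sum>i\<in>UNIV. \<Sum>j\<in>UNIV. fund_tensor (local_rep M F c) i j x y * w $ i * w $ j) > 0))"

definition finsler_manifold :: "('a, 'n::finite) manifold \<Rightarrow> (('a, 'n) tvec \<Rightarrow> real) \<Rightarrow> bool" where
  "finsler_manifold M F \<longleftrightarrow> smooth_manifold M \<and> finsler_metric M F"

text \<open>The following two notions are relative to a set \<open>W\<close> of tangent vectors, as the metric of a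
  doubly warped product is only smooth where both components are nonzero. ``Riemannian'' means
  vanishing Cartan torsion on \<open>W\<close>.\<close>

definition douglas_vanishes ::
  "('a, 'n::finite) manifold \<Rightarrow> ('a, 'n) tvec set \<Rightarrow> (('a, 'n) tvec \<Rightarrow> real) \<Rightarrow> bool" where
  "douglas_vanishes M W F \<longleftrightarrow> (\<forall>c\<in>atlas M. \<forall>v\<in>W. fst v \<in> fst c \<longrightarrow>
     (\<forall>i j k l. douglas (local_rep M F c) i j k l (snd c (fst v)) (snd v c) = 0))"

definition riemannian ::
  "('a, 'n::finite) manifold \<Rightarrow> ('a, 'n) tvec set \<Rightarrow> (('a, 'n) tvec \<Rightarrow> real) \<Rightarrow> bool" where
  "riemannian M W F \<longleftrightarrow> (\<forall>c\<in>atlas M. \<forall>v\<in>W. fst v \<in> fst c \<longrightarrow>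
     (\<forall>i j k. cartan_torsion (local_rep M F c) i j k (snd c (fst v)) (snd v c) = 0))"

section \<open>Doubly warped products\<close>

text \<open>The identification of \<open>T(M \<times> N)\<close> with \<open>TM \<times> TN\<close> is given by the differentials of the two
  projections.\<close>

definition tangent_fst ::
  "('a, 'n::finite) manifold \<Rightarrow> ('b, 'm::finite) manifold \<Rightarrow> ('a \<times> 'b, 'n + 'm) tvec
     \<Rightarrow> ('a, 'n) tvec" where
  "tangent_fst M N = tangent_map (prod_manifold M N) M fst"

definition tangent_snd ::
  "('a, 'n::finite) manifold \<Rightarrow> ('b, 'm::finite) manifold \<Rightarrow> ('a \<times> 'b, 'n + 'm) tvec
     \<Rightarrow> ('b, 'm) tvec" where
  "tangent_snd M N = tangent_map (prod_manifold M N) N snd"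

text \<open>The part of \<open>T(M \<times> N)\<close> that corresponds to the product of the slit tangent bundles.\<close>

definition bislit_bundle ::
  "('a, 'n::finite) manifold \<Rightarrow> ('b, 'm::finite) manifold \<Rightarrow> ('a \<times> 'b, 'n + 'm) tvec set" where
  "bislit_bundle M N = {v \<in> tangent_bundle (prod_manifold M N).
     tangent_fst M N v \<in> slit_tangent_bundle M \<and> tangent_snd M N v \<in> slit_tangent_bundle N}"

definition dwp_metric ::
  "('a, 'n::finite) manifold \<Rightarrow> (('a, 'n) tvec \<Rightarrow> real) \<Rightarrow> ('a \<Rightarrow> real) \<Rightarrow>
   ('b, 'm::finite) manifold \<Rightarrow> (('b, 'm) tvec \<Rightarrow> real) \<Rightarrow> ('b \<Rightarrow> real) \<Rightarrow>
   ('a \<times> 'b, 'n + 'm) tvec \<Rightarrow> real" where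
  "dwp_metric M1 F1 f1 M2 F2 f2 v =
     (let v1 = tangent_fst M1 M2 v; v2 = tangent_snd M1 M2 v in
       sqrt ((f2 (fst v2))\<^sup>2 * (F1 v1)\<^sup>2 + (f1 (fst v1))\<^sup>2 * (F2 v2)\<^sup>2))"

definition warping_function :: "('a, 'n::finite) manifold \<Rightarrow> ('a \<Rightarrow> real) \<Rightarrow> bool" where
  "warping_function M f \<longleftrightarrow> smooth_function M f \<and> (\<forall>p\<in>topspace (mtop M). f p > 0)"

end

theory Submission
  imports Defs
begin

text \<open>Fix a point \<open>(x, u)\<close>. In product coordinates the spray coefficients of \<open>F\<close> in the directions of
  the first factor have the form \<open>G\<^sup>i = A\<^sup>i(y) + \<phi>(v) Y\<^sup>i(y) - F\<^sub>2\<^sup>2(v) K\<^sup>i(y)\<close>, where \<open>\<phi>\<close> is linear and \<open>K\<close>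
  is a positive multiple of the gradient of \<open>f\<^sub>1\<^sup>2\<close> with respect to the fundamental tensor of \<open>F\<^sub>1\<close>;
  the other spray coefficients are similar. Take the component of the Douglas curvature
  with upper index \<open>i\<close> in the first factor and three lower indices in the second factor, and replace
  \<open>y\<close> by \<open>t y\<close>. The part that survives as \<open>t\<close> tends to 0 says that the third derivatives of \<open>F\<^sub>2\<^sup>2\<close>
  times \<open>K(y)\<close> are multiples of \<open>y\<close>. As \<open>K(y)\<close> cannot be radial for all \<open>y\<close> where \<open>df\<^sub>1\<close> is nonzero,
  the third derivatives of \<open>F\<^sub>2\<^sup>2\<close> vanish. Exchanging the factors, so do those of \<open>F\<^sub>1\<^sup>2\<close>. Only
  one point with nonzero \<open>df\<^sub>1\<close> and one with nonzero \<open>df\<^sub>2\<close> are needed, because the other point is arbitrary.\<close>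

section \<open>Smooth functions\<close>

lemma ck_on_has_derivative:
  "ck_on (Suc k) S f \<Longrightarrow> x \<in> S \<Longrightarrow> (f has_derivative frechet_derivative f (at x)) (at x)"
  by (simp flip: frechet_derivative_works)

text \<open>Derivatives at a point of an open set see only the values on that set, so
  \<open>f\<close> and \<open>g\<close> may differ elsewhere.\<close>

lemma ck_on_cong:
  assumes "open S" "\<And>x. x \<in> S \<Longrightarrow> f x = g x" "ck_on k S f"
  shows "ck_on k S g"
  using assms(2,3)
proof (induction k arbitrary: f g)
  case 0
  then show ?case using continuous_on_cong[of S S f g] by simp
next
  case (Suc k)
  have D: "(g has_derivative frechet_derivative f (at x)) (at x)" if "x \<in> S" for x
  proof (rule has_derivative_transform_within_open[OF _ \<open>open S\<close> that])
    show "(f has_derivative frechet_derivative f (at x)) (at x)"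
      using Suc.prems(2) that by (rule ck_on_has_derivative)
  qed (use Suc.prems in auto)
  have eq: "frechet_derivative f (at x) v = frechet_derivative g (at x) v" if "x \<in> S" for x v
    by (simp add: frechet_derivative_at[OF D[OF that]])
  have "ck_on k S (\<lambda>x. frechet_derivative g (at x) v)" for v
  proof (rule Suc.IH[of "\<lambda>x. frechet_derivative f (at x) v"])
    show "ck_on k S (\<lambda>x. frechet_derivative f (at x) v)" using Suc.prems(2) by simp
  qed (rule eq)
  then show ?case using D by (auto simp: differentiable_def)
qed

lemma smooth_on_cong:
  "\<lbrakk>open S; \<And>x. x \<in> S \<Longrightarrow> f x = g x; smooth_on S f\<rbrakk> \<Longrightarrow> smooth_on S g"
  unfolding smooth_on_def using ck_on_cong by blast

lemma ck_on_SucD: "ck_on (Suc k) S f \<Longrightarrow> ck_on k S f"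
proof (induction k arbitrary: f)
  case 0
  then show ?case
    by (auto intro!: continuous_at_imp_continuous_on differentiable_imp_continuous_within)
next
  case (Suc k)
  then show ?case by (metis ck_on.simps(2))
qed

text \<open>The derivative is unique on an open set, so an explicit formula for it may stand in for
  \<open>frechet_derivative\<close> in inductions on the order.\<close>

lemma ck_on_SucI:
  assumes "open S" "\<And>x. x \<in> S \<Longrightarrow> (f has_derivative f' x) (at x)"
    and "\<And>v. ck_on k S (\<lambda>x. f' x v)"
  shows "ck_on (Suc k) S f"
proof -
  have "frechet_derivative f (at x) = f' x" if "x \<in> S" for x
    by (rule frechet_derivative_at[OF assms(2)[OF that], symmetric])
  then have "ck_on k S (\<lambda>x. frechet_derivative f (at x) v)" for v
    using ck_on_cong[OF assms(1) _ assms(3)] by simp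
  then show ?thesis using assms(2) by (auto simp: differentiable_def)
qed

lemma smooth_on_has_derivative:
  "smooth_on S f \<Longrightarrow> x \<in> S \<Longrightarrow> (f has_derivative frechet_derivative f (at x)) (at x)"
  unfolding smooth_on_def using ck_on_has_derivative by blast

lemma smooth_on_frechet:
  "smooth_on S f \<Longrightarrow> smooth_on S (\<lambda>x. frechet_derivative f (at x) v)"
  unfolding smooth_on_def by (metis ck_on.simps(2))

lemma ck_on_const: "ck_on k S (\<lambda>x. c)"
  by (induction k arbitrary: c) auto

lemma smooth_on_const: "smooth_on S (\<lambda>x. c)"
  by (simp add: smooth_on_def ck_on_const)

lemma smooth_on_bounded_linear:
  assumes "open S" "bounded_linear f"
  shows "smooth_on S f"
proof -
  have "ck_on k S f" for k
  proof (cases k)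
    case 0
    then show ?thesis using assms(2) by (simp add: linear_continuous_on)
  next
    case (Suc l)
    then show ?thesis
      using ck_on_SucI[OF assms(1) bounded_linear_imp_has_derivative[OF assms(2)] ck_on_const]
      by blast
  qed
  then show ?thesis by (simp add: smooth_on_def)
qed

lemma ck_on_add: 
  assumes "open S" "ck_on k S f" "ck_on k S g" shows "ck_on k S (\<lambda>x. f x + g x)"
  using assms(2,3)
proof (induction k arbitrary: f g)
  case 0
  then show ?case by (simp add: continuous_on_add)
next
  case (Suc k)
  show ?case
  proof (rule ck_on_SucI[OF assms(1)])
    show "((\<lambda>x. f x + g x) has_derivative
        (\<lambda>v. frechet_derivative f (at x) v + frechet_derivative g (at x) v)) (at x)"
      if "x \<in> S" for x
      using Suc.prems that by (intro has_derivative_add ck_on_has_derivative)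
    show "ck_on k S (\<lambda>x. frechet_derivative f (at x) v + frechet_derivative g (at x) v)" for v
      using Suc.prems by (intro Suc.IH) auto
  qed
qed

lemma ck_on_mult:
  fixes f g :: "_ \<Rightarrow> real"
  assumes "open S" "ck_on k S f" "ck_on k S g" shows "ck_on k S (\<lambda>x. f x * g x)"
  using assms(2,3)
proof (induction k arbitrary: f g)
  case 0
  then show ?case by (simp add: continuous_on_mult)
next
  case (Suc k)
  show ?case
  proof (rule ck_on_SucI[OF assms(1)])
    show "((\<lambda>x. f x * g x) has_derivative
        (\<lambda>v. f x * frechet_derivative g (at x) v + frechet_derivative f (at x) v * g x)) (at x)"
      if "x \<in> S" for x
      using Suc.prems that by (intro has_derivative_mult ck_on_has_derivative)
    \<comment> \<open>Each term of the product rule keeps one factor undifferentiated;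
      \<open>ck_on_SucD\<close> lowers the order of that factor before the induction hypothesis
      applies.\<close>
    have "ck_on k S (\<lambda>x. f x * frechet_derivative g (at x) v)"
         "ck_on k S (\<lambda>x. frechet_derivative f (at x) v * g x)" for v
      using Suc.prems ck_on_SucD[OF Suc.prems(1)] ck_on_SucD[OF Suc.prems(2)]
      by (intro Suc.IH; simp)+
    then show "ck_on k S (\<lambda>x. f x * frechet_derivative g (at x) v + frechet_derivative f (at x) v * g x)"
      for v by (intro ck_on_add[OF assms(1)])
  qed
qed

lemma smooth_on_add:
  "\<lbrakk>open S; smooth_on S f; smooth_on S g\<rbrakk> \<Longrightarrow> smooth_on S (\<lambda>x. f x + g x)"
  by (simp add: smooth_on_def ck_on_add)

lemma smooth_on_mult:
  fixes f g :: "_ \<Rightarrow> real"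
  shows "\<lbrakk>open S; smooth_on S f; smooth_on S g\<rbrakk> \<Longrightarrow> smooth_on S (\<lambda>x. f x * g x)"
  by (simp add: smooth_on_def ck_on_mult)

lemma smooth_on_cmult:
  fixes f :: "_ \<Rightarrow> real"
  shows "\<lbrakk>open S; smooth_on S f\<rbrakk> \<Longrightarrow> smooth_on S (\<lambda>x. c * f x)"
  by (simp add: smooth_on_mult smooth_on_const)

lemma smooth_on_diff:
  fixes f g :: "_ \<Rightarrow> real"
  shows "\<lbrakk>open S; smooth_on S f; smooth_on S g\<rbrakk> \<Longrightarrow> smooth_on S (\<lambda>x. f x - g x)"
  using smooth_on_add[of S f "\<lambda>x. (-1) * g x"] smooth_on_cmult[of S g "-1"] by simp

lemma smooth_on_sum:
  assumes "open S" "\<And>i. i \<in> I \<Longrightarrow> smooth_on S (f i)"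
  shows "smooth_on S (\<lambda>x. \<Sum>i\<in>I. f i x)"
  using assms(2)
  by (induction I rule: infinite_finite_induct) (auto intro!: smooth_on_const smooth_on_add assms(1))

lemma smooth_on_prod:
  fixes f :: "_ \<Rightarrow> _ \<Rightarrow> real"
  assumes "open S" "\<And>i. i \<in> I \<Longrightarrow> smooth_on S (f i)"
  shows "smooth_on S (\<lambda>x. \<Prod>i\<in>I. f i x)"
  using assms(2)
  by (induction I rule: infinite_finite_induct) (auto intro!: smooth_on_const smooth_on_mult assms(1))

lemma smooth_on_power2:
  fixes f :: "_ \<Rightarrow> real"
  shows "\<lbrakk>open S; smooth_on S f\<rbrakk> \<Longrightarrow> smooth_on S (\<lambda>x. (f x)\<^sup>2)"
  by (simp add: power2_eq_square smooth_on_mult)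

text \<open>The derivative of \<open>1 / f\<close> is a product of two factors \<open>1 / f\<close>
  and a derivative of \<open>f\<close>, so each order of smoothness is gained from the previous
  one.\<close>

lemma smooth_on_inverse:
  fixes f :: "_ \<Rightarrow> real"
  assumes "open S" "smooth_on S f" "\<And>x. x \<in> S \<Longrightarrow> f x \<noteq> 0"
  shows "smooth_on S (\<lambda>x. inverse (f x))"
proof -
  have f: "ck_on k S f" for k using assms(2) by (simp add: smooth_on_def)
  have "ck_on k S (\<lambda>x. inverse (f x))" for k
  proof (induction k)
    case 0
    then show ?case using f[of 0] assms(3) by (auto intro: continuous_on_inverse)
  next
    case (Suc k)
    show ?case
    proof (rule ck_on_SucI[OF assms(1)])
      show "((\<lambda>x. inverse (f x)) has_derivative
          (\<lambda>v. (-1) * (inverse (f x) * frechet_derivative f (at x) v * inverse (f x)))) (at x)"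
        if "x \<in> S" for x
        using Deriv.has_derivative_inverse[OF assms(3)[OF that] ck_on_has_derivative[OF f that]] by simp
      show "ck_on k S (\<lambda>x. (-1) * (inverse (f x) * frechet_derivative f (at x) v * inverse (f x)))" for v
        using f[of "Suc k"] by (intro ck_on_mult assms(1) ck_on_const Suc) auto
    qed
  qed
  then show ?thesis by (simp add: smooth_on_def)
qed

section \<open>Determinants and matrix inverses\<close>

lemma smooth_on_det:
  fixes A :: "'a::real_normed_vector \<Rightarrow> real ^ 'n ^ 'n"
  assumes "open S" "\<And>i j. smooth_on S (\<lambda>x. A x $ i $ j)"
  shows "smooth_on S (\<lambda>x. det (A x))"
  unfolding det_def
  by (intro smooth_on_sum smooth_on_mult smooth_on_const smooth_on_prod assms)

lemma matrix_inv_right_det: 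
  fixes A :: "real ^ 'n ^ 'n"
  assumes "det A \<noteq> 0" shows "A ** matrix_inv A = mat 1"
proof -
  from assms have "\<exists>B. A ** B = mat 1 \<and> B ** A = mat 1"
    using invertible_det_nz unfolding invertible_def by blast
  from someI_ex[OF this] show ?thesis unfolding matrix_inv_def by simp
qed

lemma matrix_inv_eqI:
  fixes A :: "real ^ 'n ^ 'n"
  assumes "A ** B = mat 1" shows "matrix_inv A = B"
proof -
  have "B ** A = mat 1" using assms matrix_left_right_inverse by blast
  moreover have "A ** matrix_inv A = mat 1"
    using assms by (intro matrix_inv_right_det) (metis det_I det_mul mult_zero_left zero_neq_one)
  ultimately show ?thesis
    by (metis matrix_mul_assoc matrix_mul_lid matrix_mul_rid)
qed

text \<open>Cramer's rule for the \<open>j\<close>-th column of the inverse. As a quotient of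
  determinants, each entry is visibly smooth in the entries of \<open>A\<close>.\<close>

lemma matrix_inv_component:
  fixes A :: "real ^ 'n ^ 'n"
  assumes "det A \<noteq> 0"
  shows "matrix_inv A $ i $ j = det (\<chi> r s. if s = i then axis j 1 $ r else A $ r $ s) * inverse (det A)"
proof -
  have "A *v column j (matrix_inv A) = axis j 1"
  proof -
    have "A *v column j (matrix_inv A) = column j (A ** matrix_inv A)"
      by (simp add: vec_eq_iff column_def matrix_vector_mult_def matrix_matrix_mult_def)
    then show ?thesis
      by (simp add: matrix_inv_right_det[OF assms] column_def mat_def axis_def vec_eq_iff)
  qed
  then have "column j (matrix_inv A) = (\<chi> k. det (\<chi> r s. if s = k then axis j 1 $ r else A $ r $ s) / det A)"
    using cramer[OF assms] by blast
  then have "column j (matrix_inv A) $ i = det (\<chi> r s. if s = i then axis j 1 $ r else A $ r $ s) / det A"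
    by simp
  then show ?thesis by (simp add: column_def field_simps)
qed

lemma smooth_on_matrix_inv:
  fixes A :: "'a::real_normed_vector \<Rightarrow> real ^ 'n ^ 'n"
  assumes "open S" "\<And>i j. smooth_on S (\<lambda>x. A x $ i $ j)" "\<And>x. x \<in> S \<Longrightarrow> det (A x) \<noteq> 0"
  shows "smooth_on S (\<lambda>x. matrix_inv (A x) $ i $ j)"
proof (rule smooth_on_cong[OF assms(1)])
  show "smooth_on S (\<lambda>x. det (\<chi> r s. if s = i then axis j 1 $ r else A x $ r $ s) * inverse (det (A x)))"
  proof (intro smooth_on_mult smooth_on_inverse smooth_on_det assms)
    show "smooth_on S (\<lambda>x. (\<chi> r s. if s = i then axis j 1 $ r else A x $ r $ s) $ k $ l)" for k l
      by (cases "l = i") (simp_all add: smooth_on_const assms)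
  qed
qed (simp add: matrix_inv_component assms(3))

section \<open>Functions of two vector variables\<close>

lemma has_derivative_slices:
  assumes "(f has_derivative f') (at (x, y))"
  shows "((\<lambda>x. f (x, y)) has_derivative (\<lambda>v. f' (v, 0))) (at x)"
    and "((\<lambda>y. f (x, y)) has_derivative (\<lambda>v. f' (0, v))) (at y)"
  by (rule has_derivative_compose[where f = "\<lambda>x. (x, y)" and g = f, OF _ assms]
      has_derivative_compose[where f = "\<lambda>y. (x, y)" and g = f, OF _ assms],
      auto intro!: has_derivative_Pair)+

text \<open>A directional derivative of a slice is a slice of the derivative of \<open>f\<close> in
  the direction \<open>(v, 0)\<close> or \<open>(0, v)\<close>, so the induction on the order goes
  through for arbitrary \<open>f\<close>.\<close>

lemma smooth_on_slices:
  fixes f :: "'a::real_normed_vector \<times> 'b::real_normed_vector \<Rightarrow> 'c::real_normed_vector"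
  assumes "open S" "open T" "smooth_on (S \<times> T) f"
  shows "y \<in> T \<Longrightarrow> smooth_on S (\<lambda>x. f (x, y))" "x \<in> S \<Longrightarrow> smooth_on T (\<lambda>y. f (x, y))"
proof -
  have "ck_on k S (\<lambda>x. f (x, y))" if "ck_on k (S \<times> T) f" "y \<in> T" for k y
    using that
  proof (induction k arbitrary: f)
    case 0
    then show ?case by (auto intro!: continuous_on_compose2[of "S \<times> T" f] continuous_intros)
  next
    case (Suc k)
    show ?case
    proof (rule ck_on_SucI[OF assms(1)])
      show "((\<lambda>x. f (x, y)) has_derivative (\<lambda>v. frechet_derivative f (at (x, y)) (v, 0))) (at x)"
        if "x \<in> S" for x
        using that Suc.prems(2) by (intro has_derivative_slices(1) ck_on_has_derivative[OF Suc.prems(1)]) auto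
      show "ck_on k S (\<lambda>x. frechet_derivative f (at (x, y)) (v, 0))" for v
        using Suc.prems by (intro Suc.IH[of "\<lambda>z. frechet_derivative f (at z) (v, 0)"]) auto
    qed
  qed
  then show "y \<in> T \<Longrightarrow> smooth_on S (\<lambda>x. f (x, y))"
    using assms(3) by (simp add: smooth_on_def)
  have "ck_on k T (\<lambda>y. f (x, y))" if "ck_on k (S \<times> T) f" "x \<in> S" for k x
    using that
  proof (induction k arbitrary: f)
    case 0
    then show ?case by (auto intro!: continuous_on_compose2[of "S \<times> T" f] continuous_intros)
  next
    case (Suc k)
    show ?case
    proof (rule ck_on_SucI[OF assms(2)])
      show "((\<lambda>y. f (x, y)) has_derivative (\<lambda>v. frechet_derivative f (at (x, y)) (0, v))) (at y)"
        if "y \<in> T" for y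
        using that Suc.prems(2) by (intro has_derivative_slices(2) ck_on_has_derivative[OF Suc.prems(1)]) auto
      show "ck_on k T (\<lambda>y. frechet_derivative f (at (x, y)) (0, v))" for v
        using Suc.prems by (intro Suc.IH[of "\<lambda>z. frechet_derivative f (at z) (0, v)"]) auto
    qed
  qed
  then show "x \<in> S \<Longrightarrow> smooth_on T (\<lambda>y. f (x, y))"
    using assms(3) by (simp add: smooth_on_def)
qed

lemma open_slit: "open (UNIV - {0 :: 'a::real_normed_vector})"
  by auto

section \<open>Coordinate derivatives\<close>

text \<open>Freezing \<open>x\<close> turns iterated \<open>dy\<close> into iterated
  \<open>pd\<close> of one function of \<open>y\<close>, to which the smoothness lemmas apply
  directly.\<close>

definition pd :: "'n \<Rightarrow> (real ^ 'n \<Rightarrow> real) \<Rightarrow> real ^ 'n::finite \<Rightarrow> real" where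
  "pd i h x = deriv (\<lambda>t. h (x + t *\<^sub>R axis i 1)) 0"

lemma dx_pd: "dx i L x y = pd i (\<lambda>x. L x y) x"
  by (simp add: dx_def pd_def)

lemma dy_pd: "dy i L x = pd i (L x)"
  by (rule ext) (simp add: dy_def pd_def)

lemma pd_eqI:
  "((\<lambda>t. h (x + t *\<^sub>R axis i 1)) has_field_derivative d) (at 0) \<Longrightarrow> pd i h x = d"
  by (simp add: pd_def DERIV_imp_deriv)

lemma pd_const: "pd i (\<lambda>x. c) y = 0"
  by (simp add: pd_def)

lemma has_derivative_imp_DERIV_line:
  fixes h :: "real ^ 'n \<Rightarrow> real"
  assumes "(h has_derivative h') (at x)"
  shows "((\<lambda>t. h (x + t *\<^sub>R axis i 1)) has_field_derivative h' (axis i 1)) (at 0)"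
proof -
  interpret bounded_linear h' using assms by (rule has_derivative_bounded_linear)
  have "((\<lambda>t::real. x + t *\<^sub>R axis i 1) has_derivative (\<lambda>t. t *\<^sub>R axis i 1)) (at 0)"
    by (auto intro!: derivative_eq_intros)
  from has_derivative_compose[OF this, of h h'] assms show ?thesis
    by (simp add: has_field_derivative_def scale mult_commute_abs)
qed

lemma smooth_on_DERIV_pd:
  fixes h :: "real ^ 'n \<Rightarrow> real"
  assumes "smooth_on S h" "x \<in> S"
  shows "((\<lambda>t. h (x + t *\<^sub>R axis i 1)) has_field_derivative pd i h x) (at 0)"
  proof -
  note D = has_derivative_imp_DERIV_line[OF smooth_on_has_derivative[OF assms], of i]
  then show ?thesis using pd_eqI[OF D] by simp
qed

lemma pd_frechet:
  "smooth_on S h \<Longrightarrow> x \<in> S \<Longrightarrow> pd i h x = frechet_derivative h (at x) (axis i 1)"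
  by (rule pd_eqI has_derivative_imp_DERIV_line smooth_on_has_derivative)+

lemma smooth_on_pd:
  "open S \<Longrightarrow> smooth_on S h \<Longrightarrow> smooth_on S (pd i h)"
  by (rule smooth_on_cong[OF _ _ smooth_on_frechet]) (auto simp: pd_frechet)

lemma eventually_line_in_open:
  fixes x :: "real ^ 'n"
  assumes "open S" "x \<in> S"
  shows "\<forall>\<^sub>F t in nhds (0::real). x + t *\<^sub>R axis i 1 \<in> S"
proof -
  have "isCont (\<lambda>t::real. x + t *\<^sub>R axis i 1) 0" by (intro continuous_intros)
  then have "((\<lambda>t::real. x + t *\<^sub>R axis i 1) \<longlongrightarrow> x) (nhds 0)"
    by (simp add: tendsto_nhds_iff isCont_def)
  then show ?thesis using assms topological_tendstoD by blast
qed

lemma pd_cong: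
  assumes "open S" "x \<in> S" "\<And>x. x \<in> S \<Longrightarrow> h x = g x"
  shows "pd i h x = pd i g x"
  unfolding pd_def
  by (rule deriv_cong_ev) (auto intro: eventually_mono[OF eventually_line_in_open[OF assms(1,2)]] assms(3))

text \<open>Four summands is the longest combination that occurs below, in the mean Berwald
  curvature; the shorter versions arise by setting coefficients to 0.\<close>

lemma pd_lin4:
  assumes "open S" "x \<in> S" "smooth_on S h1" "smooth_on S h2" "smooth_on S h3" "smooth_on S h4"
    and "\<And>x. x \<in> S \<Longrightarrow> h x = a1 * h1 x + a2 * h2 x + a3 * h3 x + a4 * h4 x"
  shows "pd i h x = a1 * pd i h1 x + a2 * pd i h2 x + a3 * pd i h3 x + a4 * pd i h4 x"
proof -
  have "pd i h x = pd i (\<lambda>x. a1 * h1 x + a2 * h2 x + a3 * h3 x + a4 * h4 x) x"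
    using assms by (intro pd_cong) auto
  also have "\<dots> = a1 * pd i h1 x + a2 * pd i h2 x + a3 * pd i h3 x + a4 * pd i h4 x"
    by (rule pd_eqI) (intro DERIV_add DERIV_cmult smooth_on_DERIV_pd[OF assms(3,2)]
        smooth_on_DERIV_pd[OF assms(4,2)] smooth_on_DERIV_pd[OF assms(5,2)] smooth_on_DERIV_pd[OF assms(6,2)])
  finally show ?thesis .
qed

lemma pd_lin2:
  assumes "open S" "x \<in> S" "smooth_on S h1" "smooth_on S h2"
    and "\<And>x. x \<in> S \<Longrightarrow> h x = a1 * h1 x + a2 * h2 x"
  shows "pd i h x = a1 * pd i h1 x + a2 * pd i h2 x"
  using pd_lin4[OF assms(1-4) assms(3,3), of h a1 a2 0 0] assms(5) by simp

lemma pd_lin3: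
  assumes "open S" "x \<in> S" "smooth_on S h1" "smooth_on S h2" "smooth_on S h3"
    and "\<And>x. x \<in> S \<Longrightarrow> h x = a1 * h1 x + a2 * h2 x + a3 * h3 x"
  shows "pd i h x = a1 * pd i h1 x + a2 * pd i h2 x + a3 * pd i h3 x"
  using pd_lin4[OF assms(1-5) assms(3), of h a1 a2 a3 0] assms(6) by simp

lemma pd_lin1:
  assumes "open S" "x \<in> S" "smooth_on S h1" "\<And>x. x \<in> S \<Longrightarrow> h x = a * h1 x"
  shows "pd i h x = a * pd i h1 x"
  using pd_lin2[OF assms(1-3) assms(3), of h a 0] assms(4) by simp

lemma pd_eq_0:
  assumes "open S" "x \<in> S" "\<And>x. x \<in> S \<Longrightarrow> h x = c"
  shows "pd i h x = 0"
  using pd_cong[OF assms] by (simp add: pd_const)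

text \<open>The derivative of \<open>h (t (y + s e_i))\<close> in \<open>s\<close> at 0 is computed
  once by the chain rule and once from the scaling law. With \<open>c = t ^ k\<close> this says that
  a derivative lowers the degree of homogeneity by one.\<close>

lemma pd_scale:
  fixes h :: "real ^ 'n \<Rightarrow> real"
  assumes "t > 0" "c \<noteq> 0" "smooth_on (UNIV - {0}) h" "\<And>y. y \<noteq> 0 \<Longrightarrow> h (t *\<^sub>R y) = c * h y" "y \<noteq> 0"
  shows "pd i h (t *\<^sub>R y) = c / t * pd i h y"
proof -
  let ?e = "axis i (1::real) :: real ^ 'n"
  have ev: "\<forall>\<^sub>F s in nhds (0::real). y + s *\<^sub>R ?e \<in> UNIV - {0}"
    using \<open>y \<noteq> 0\<close> by (intro eventually_line_in_open) auto
  have "((\<lambda>s. h (t *\<^sub>R y + s *\<^sub>R ?e)) has_field_derivative pd i h (t *\<^sub>R y)) (at 0)"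
    using assms by (intro smooth_on_DERIV_pd) auto
  moreover have "((\<lambda>s. t * s) has_field_derivative t) (at 0)"
    by (auto intro!: derivative_eq_intros)
  ultimately have "((\<lambda>s. h (t *\<^sub>R y + (t * s) *\<^sub>R ?e)) has_field_derivative pd i h (t *\<^sub>R y) * t) (at 0)"
    using DERIV_chain2[of "\<lambda>s. h (t *\<^sub>R y + s *\<^sub>R ?e)" _ "\<lambda>s. t * s" 0 t UNIV] by simp
  then have 1: "deriv (\<lambda>s. h (t *\<^sub>R (y + s *\<^sub>R ?e))) 0 = pd i h (t *\<^sub>R y) * t"
    by (simp add: DERIV_imp_deriv scaleR_add_right)
  have "((\<lambda>s. c * h (y + s *\<^sub>R ?e)) has_field_derivative c * pd i h y) (at 0)"
    using assms by (intro DERIV_cmult smooth_on_DERIV_pd[where S = "UNIV - {0}"]) auto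
  then have "deriv (\<lambda>s. h (t *\<^sub>R (y + s *\<^sub>R ?e))) 0 = c * pd i h y"
    using deriv_cong_ev[of "\<lambda>s. h (t *\<^sub>R (y + s *\<^sub>R ?e))" "\<lambda>s. c * h (y + s *\<^sub>R ?e)" 0 0]
      eventually_mono[OF ev, of "\<lambda>s. h (t *\<^sub>R (y + s *\<^sub>R ?e)) = c * h (y + s *\<^sub>R ?e)"] assms(4)
    by (simp add: DERIV_imp_deriv)
  then show ?thesis using 1 \<open>t > 0\<close> by (simp add: field_simps)
qed

text \<open>Joint smoothness survives a derivative in one block. This permits a derivative in
  \<open>y\<close> followed by one in \<open>x\<close>, as in the mixed term of the spray
  coefficients, before a variable is frozen.\<close>

lemma smooth_on_pd_slices:
  fixes f :: "(real ^ 'n::finite) \<times> (real ^ 'm::finite) \<Rightarrow> real"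
  assumes "open S" "open T" "smooth_on (S \<times> T) f"
  shows "smooth_on (S \<times> T) (\<lambda>(x, y). pd i (\<lambda>x. f (x, y)) x)"
    and "smooth_on (S \<times> T) (\<lambda>(x, y). pd j (\<lambda>y. f (x, y)) y)"
proof -
  have D: "((\<lambda>x. f (x, y)) has_derivative (\<lambda>v. frechet_derivative f (at (x, y)) (v, 0))) (at x)"
       "((\<lambda>y. f (x, y)) has_derivative (\<lambda>v. frechet_derivative f (at (x, y)) (0, v))) (at y)"
    if "x \<in> S" "y \<in> T" for x y
  proof -
    have "(f has_derivative frechet_derivative f (at (x, y))) (at (x, y))"
      using assms(3) that by (intro smooth_on_has_derivative) auto
    then show "((\<lambda>x. f (x, y)) has_derivative (\<lambda>v. frechet_derivative f (at (x, y)) (v, 0))) (at x)"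
       "((\<lambda>y. f (x, y)) has_derivative (\<lambda>v. frechet_derivative f (at (x, y)) (0, v))) (at y)"
      by (rule has_derivative_slices)+
  qed
  show "smooth_on (S \<times> T) (\<lambda>(x, y). pd i (\<lambda>x. f (x, y)) x)"
    by (rule smooth_on_cong[OF _ _ smooth_on_frechet[OF assms(3), of "(axis i 1, 0)"]])
      (use assms in \<open>auto simp: open_Times dest!: D(1)
        intro!: pd_eqI[OF has_derivative_imp_DERIV_line, symmetric]\<close>)
  show "smooth_on (S \<times> T) (\<lambda>(x, y). pd j (\<lambda>y. f (x, y)) y)"
    by (rule smooth_on_cong[OF _ _ smooth_on_frechet[OF assms(3), of "(0, axis j 1)"]])
      (use assms in \<open>auto simp: open_Times dest!: D(2)
        intro!: pd_eqI[OF has_derivative_imp_DERIV_line, symmetric]\<close>)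
qed

lemma pd_linear: "pd a (\<lambda>v :: real ^ 'n::finite. \<Sum>c\<in>UNIV. \<beta> c * v $ c) v = \<beta> a"
proof -
  have "((\<lambda>v. \<Sum>c\<in>UNIV. \<beta> c * v $ c) has_derivative (\<lambda>h. \<Sum>c\<in>UNIV. \<beta> c * h $ c)) (at v)"
    by (intro bounded_linear_imp_has_derivative bounded_linear_sum bounded_linear_const_mult bounded_linear_vec_nth)
  from pd_eqI[OF has_derivative_imp_DERIV_line[OF this], of a] show ?thesis
    by (simp add: axis_def if_distrib[of "\<lambda>z. _ * z"] cong: if_cong)
qed

lemma smooth_on_linear: "open S \<Longrightarrow> smooth_on S (\<lambda>v :: real ^ 'n::finite. \<Sum>c\<in>UNIV. \<beta> c * v $ c)"
  by (intro smooth_on_bounded_linear bounded_linear_sum bounded_linear_const_mult bounded_linear_vec_nth)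

text \<open>Two derivatives remove everything affine in \<open>v\<close>. In the application
  \<open>h\<close> is \<open>F_2^2\<close>, and \<open>g\<close> is a spray coefficient of the first
  factor, or its derivative in \<open>y\<close>, as a function of \<open>v\<close>.\<close>

lemma pd_pd_affine_add:
  fixes g h :: "real ^ 'n::finite \<Rightarrow> real"
  assumes "smooth_on (UNIV - {0}) h" "v \<noteq> 0"
    and "\<And>v. v \<noteq> 0 \<Longrightarrow> g v = p + (\<Sum>c\<in>UNIV. \<beta> c * v $ c) * q - h v * r"
  shows "pd a (pd b g) v = - r * pd a (pd b h) v"
proof -
  have "pd b g v = (q * \<beta> b) * 1 + (- r) * pd b h v" if "v \<noteq> 0" for v
    using pd_lin3[OF open_slit _ smooth_on_const[of _ 1] smooth_on_linear[OF open_slit] assms(1),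
        of v g p q \<beta> "- r" b] that assms(3)
    by (simp add: pd_const pd_linear algebra_simps)
  then show ?thesis
    using pd_lin2[OF open_slit _ smooth_on_const[of _ 1] smooth_on_pd[OF open_slit assms(1)],
        of v "pd b g" "q * \<beta> b" "- r" b a] assms(2)
    by (simp add: pd_const)
qed

text \<open>A cubic polynomial that vanishes at 1, 2, 3 and 4 is the zero polynomial.\<close>

lemma cubic_eq_0_imp:
  fixes c0 c1 c2 c3 :: real
  assumes "\<And>t. t > 0 \<Longrightarrow> c0 + t * c1 + t\<^sup>2 * c2 + t ^ 3 * c3 = 0"
  shows "c0 = 0"
  using assms[of 1] assms[of 2] assms[of 3] assms[of 4] by simp

section \<open>The local computation\<close>

lemma fund_tensor_pd: "fund_tensor L i j x = (\<lambda>y. 1/2 * pd i (pd j (\<lambda>y. (L x y)\<^sup>2)) y)"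
  by (rule ext) (simp add: fund_tensor_def dy_pd)

lemma spray_coeff_pd:
  "spray_coeff L i x y = 1/4 * (\<Sum>l\<in>UNIV. fund_inverse L i l x y *
     ((\<Sum>k\<in>UNIV. pd k (\<lambda>x. pd l (\<lambda>y. (L x y)\<^sup>2) y) x * y $ k) - pd l (\<lambda>x. (L x y)\<^sup>2) x))"
  by (simp add: spray_coeff_def dy_pd dx_pd)

lemma mean_berwald_pd:
  "mean_berwald L j k x = (\<lambda>y. 1/2 * (\<Sum>m\<in>UNIV. pd j (pd k (pd m (spray_coeff L m x))) y))"
  by (rule ext) (simp add: mean_berwald_def berwald_def dy_pd)

lemma ex_kernel_vector:
  fixes \<alpha> :: "'n::finite \<Rightarrow> real"
  assumes "i \<noteq> (j :: 'n)"
  shows "\<exists>y :: real ^ 'n. y \<noteq> 0 \<and> (\<Sum>l\<in>UNIV. \<alpha> l * y $ l) = 0"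
proof -
  have S: "(\<Sum>l\<in>UNIV. \<alpha> l * (a *\<^sub>R axis i 1 + b *\<^sub>R axis j 1 :: real ^ 'n) $ l) = \<alpha> i * a + \<alpha> j * b" for a b
    by (simp add: axis_def algebra_simps sum.distrib if_distrib[of "\<lambda>z. _ * z"] cong: if_cong)
  show ?thesis
  proof (cases "\<alpha> j = 0")
    case True
    then show ?thesis using S[of 0 1] by (intro exI[of _ "axis j 1"]) (auto simp: axis_eq_0_iff)
  next
    case False
    \<comment> \<open>The two contributions to the pairing with \<open>\<alpha>\<close> cancel, and
      the coordinate \<open>i\<close> of this vector is \<open>\<alpha> j\<close>, which is nonzero
      in this case.\<close>
    let ?y = "\<alpha> j *\<^sub>R axis i 1 + (- \<alpha> i) *\<^sub>R axis j 1 :: real ^ 'n"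
    have "?y $ i = \<alpha> j" using assms by (simp add: axis_def)
    then have "?y \<noteq> 0" using False by (metis zero_index)
    then show ?thesis using S[of "\<alpha> j" "- \<alpha> i"] by (intro exI[of _ ?y]) (auto simp: algebra_simps)
  qed
qed

section \<open>Finsler metrics on a coordinate domain\<close>

locale finsler_local =
  fixes U :: "(real ^ 'n::finite) set" and L :: "real ^ 'n \<Rightarrow> real ^ 'n \<Rightarrow> real"
  assumes open_U: "open U"
    and smooth_L: "smooth_on (U \<times> (UNIV - {0})) (\<lambda>(x, y). L x y)"
    and homogeneous: "\<And>x y t. x \<in> U \<Longrightarrow> t > 0 \<Longrightarrow> L x (t *\<^sub>R y) = t * L x y"
    and pos_def: "\<And>x y w. x \<in> U \<Longrightarrow> y \<noteq> 0 \<Longrightarrow> w \<noteq> 0 \<Longrightarrow>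
      (\<Sum>i\<in>UNIV. \<Sum>j\<in>UNIV. fund_tensor L i j x y * w $ i * w $ j) > 0"
begin

abbreviation H :: "real ^ 'n \<Rightarrow> real ^ 'n \<Rightarrow> real" where
  "H x y \<equiv> (L x y)\<^sup>2"

abbreviation G :: "real ^ 'n \<Rightarrow> real ^ 'n \<Rightarrow> real ^ 'n ^ 'n" where
  "G x y \<equiv> \<chi> i j. fund_tensor L i j x y"

lemma smooth_H: "smooth_on (U \<times> (UNIV - {0})) (\<lambda>(x, y). H x y)"
proof -
  have "smooth_on (U \<times> (UNIV - {0})) (\<lambda>z. ((\<lambda>(x, y). L x y) z)\<^sup>2)"
    by (intro smooth_on_power2 smooth_L open_Times open_U open_slit)
  then show ?thesis by (simp add: case_prod_unfold)
qed

lemma smooth_H_fst: "y \<noteq> 0 \<Longrightarrow> smooth_on U (\<lambda>x. H x y)"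
  and smooth_H_snd: "x \<in> U \<Longrightarrow> smooth_on (UNIV - {0}) (H x)"
  using smooth_on_slices[OF open_U open_slit smooth_H] by auto

lemma smooth_pd_H: "smooth_on (U \<times> (UNIV - {0})) (\<lambda>(x, y). pd l (H x) y)"
  using smooth_on_pd_slices(2)[OF open_U open_slit smooth_H, of l] by simp

lemma smooth_pd_H_fst: "y \<noteq> 0 \<Longrightarrow> smooth_on U (\<lambda>x. pd l (H x) y)"
  using smooth_on_slices(1)[OF open_U open_slit smooth_pd_H] by auto

lemma smooth_dx_H:
  assumes "x \<in> U" shows "smooth_on (UNIV - {0}) (\<lambda>y. pd l (\<lambda>x. H x y) x)"
  using smooth_on_slices(2)[OF open_U open_slit smooth_on_pd_slices(1)[OF open_U open_slit smooth_H]] assms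
  by auto

lemma smooth_dx_pd_H:
  assumes "x \<in> U" shows "smooth_on (UNIV - {0}) (\<lambda>y. pd k (\<lambda>x. pd l (H x) y) x)"
  using smooth_on_slices(2)[OF open_U open_slit smooth_on_pd_slices(1)[OF open_U open_slit smooth_pd_H]] assms
  by auto

lemma smooth_fund_tensor:
  "x \<in> U \<Longrightarrow> smooth_on (UNIV - {0}) (fund_tensor L i j x)"
  unfolding fund_tensor_pd by (intro smooth_on_cmult smooth_on_pd smooth_H_snd open_slit)

text \<open>On a kernel vector the quadratic form of \<open>G\<close> vanishes, so positive
  definiteness leaves only the zero vector.\<close>

lemma det_G:
  assumes "x \<in> U" "y \<noteq> 0" shows "det (G x y) \<noteq> 0"
proof -
  have "w = 0" if "G x y *v w = 0" for w
  proof (rule ccontr)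
    assume "w \<noteq> 0"
    have "(\<Sum>i\<in>UNIV. \<Sum>j\<in>UNIV. fund_tensor L i j x y * w $ i * w $ j)
        = (\<Sum>i\<in>UNIV. w $ i * (G x y *v w) $ i)"
      by (simp add: matrix_vector_mult_def sum_distrib_left algebra_simps)
    then show False using pos_def[OF assms \<open>w \<noteq> 0\<close>] that by simp
  qed
  then have "invertible (G x y)"
    using matrix_left_invertible_ker[of "G x y"] invertible_left_inverse by blast
  then show ?thesis using invertible_det_nz by blast
qed

lemma G_inverse:
  assumes "x \<in> U" "y \<noteq> 0"
  shows "(\<Sum>l\<in>UNIV. fund_tensor L i l x y * fund_inverse L l j x y) = (if i = j then 1 else 0)"
proof -
  have "(G x y ** matrix_inv (G x y)) $ i $ j = (if i = j then 1 else 0)"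
    by (simp add: matrix_inv_right_det[OF det_G[OF assms]] mat_def)
  then show ?thesis by (simp add: fund_inverse_def matrix_matrix_mult_def)
qed

lemma smooth_fund_inverse:
  "x \<in> U \<Longrightarrow> smooth_on (UNIV - {0}) (\<lambda>y. fund_inverse L i j x y)"
  unfolding fund_inverse_def
  by (intro smooth_on_matrix_inv open_slit) (auto simp: smooth_fund_tensor det_G)

lemma smooth_spray_coeff:
  assumes "x \<in> U" shows "smooth_on (UNIV - {0}) (spray_coeff L i x)"
  unfolding spray_coeff_pd
  by (intro smooth_on_cmult smooth_on_sum smooth_on_mult smooth_on_diff smooth_fund_inverse
      smooth_dx_H smooth_dx_pd_H assms open_slit smooth_on_bounded_linear bounded_linear_vec_nth)

text \<open>\<open>H\<close> has degree 2 in \<open>y\<close>, and each of the two derivatives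
  lowers the degree by one.\<close>

lemma fund_tensor_scale:
  assumes "x \<in> U" "y \<noteq> 0" "t > 0"
  shows "fund_tensor L i j x (t *\<^sub>R y) = fund_tensor L i j x y"
proof -
  have 1: "pd j (H x) (t *\<^sub>R y) = t * pd j (H x) y" if "y \<noteq> 0" for y
    using pd_scale[of t "t\<^sup>2" "H x" y j] that assms smooth_H_snd[OF assms(1)] homogeneous
    by (simp add: power_mult_distrib power2_eq_square)
  have "pd i (pd j (H x)) (t *\<^sub>R y) = t / t * pd i (pd j (H x)) y"
    using assms by (intro pd_scale smooth_on_pd open_slit smooth_H_snd 1) auto
  then show ?thesis using assms by (simp add: fund_tensor_pd)
qed

text \<open>Raises the index of a covector at \<open>x\<close> with the inverse fundamental tensor
  at \<open>y\<close>. The resulting vector varies with the direction \<open>y\<close>, and for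
  fixed \<open>\<alpha>\<close> it is homogeneous of degree 0.\<close>

definition raise :: "real ^ 'n \<Rightarrow> ('n \<Rightarrow> real) \<Rightarrow> 'n \<Rightarrow> real ^ 'n \<Rightarrow> real" where
  "raise x \<alpha> i y = (\<Sum>l\<in>UNIV. fund_inverse L i l x y * \<alpha> l)"

lemma smooth_raise:
  "x \<in> U \<Longrightarrow> smooth_on (UNIV - {0}) (raise x \<alpha> i)"
  unfolding raise_def
  by (intro smooth_on_sum smooth_on_mult smooth_fund_inverse open_slit smooth_on_const)

lemma raise_scale:
  "\<lbrakk>x \<in> U; y \<noteq> 0; t > 0\<rbrakk> \<Longrightarrow> raise x \<alpha> i (t *\<^sub>R y) = raise x \<alpha> i y"
  by (simp add: raise_def fund_inverse_def fund_tensor_scale)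

lemma pd_raise_scale:
  assumes "x \<in> U" "y \<noteq> 0" "t > 0"
  shows "pd j (raise x \<alpha> i) (t *\<^sub>R y) = pd j (raise x \<alpha> i) y / t"
  using pd_scale[of t 1 "raise x \<alpha> i" y j] assms by (simp add: smooth_raise raise_scale)

lemma lower_raise:
  assumes "x \<in> U" "y \<noteq> 0"
  shows "(\<Sum>i\<in>UNIV. fund_tensor L j i x y * raise x \<alpha> i y) = \<alpha> j"
proof -
  have "(\<Sum>i\<in>UNIV. fund_tensor L j i x y * raise x \<alpha> i y)
      = (\<Sum>i\<in>UNIV. \<Sum>l\<in>UNIV. fund_tensor L j i x y * fund_inverse L i l x y * \<alpha> l)"
    by (simp add: raise_def sum_distrib_left mult.assoc)
  also have "\<dots> = (\<Sum>l\<in>UNIV. \<Sum>i\<in>UNIV. fund_tensor L j i x y * fund_inverse L i l x y * \<alpha> l)"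
    by (rule sum.swap)
  also have "\<dots> = (\<Sum>l\<in>UNIV. (if j = l then 1 else 0) * \<alpha> l)"
    by (simp add: G_inverse[OF assms] flip: sum_distrib_right)
  also have "\<dots> = \<alpha> j" by (simp add: if_distrib[of "\<lambda>z. z * _"] cong: if_cong)
  finally show ?thesis .
qed

text \<open>In dimension 1 the set \<open>{z. 0 < z $ i * y $ i}\<close> is the open ray through
  \<open>y\<close>, on which a function of degree 0 is constant.\<close>

lemma pd_raise_dim_1:
  assumes "x \<in> U" "y \<noteq> 0" "\<And>i j :: 'n. i = j"
  shows "pd i (raise x \<alpha> j) y = 0"
proof (rule pd_eq_0[of "{z. 0 < z $ i * y $ i}"])
  show "open {z. 0 < z $ i * y $ i}" by (intro open_Collect_less continuous_intros)
  have [simp]: "y $ i \<noteq> 0" using assms(2,3) by (metis vec_eq_iff zero_index)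
  show "y \<in> {z. 0 < z $ i * y $ i}" by (simp add: zero_less_mult_iff) (meson linorder_neqE_linordered_idom \<open>y $ i \<noteq> 0\<close>)
  fix z assume z: "z \<in> {z. 0 < z $ i * y $ i}"
  have "z = (z $ i / y $ i) *\<^sub>R y"
  proof (unfold vec_eq_iff, intro allI)
    fix k
    have "k = i" by (rule assms(3))
    then show "z $ k = ((z $ i / y $ i) *\<^sub>R y) $ k" by simp
  qed
  moreover have "z $ i / y $ i > 0"
    using z by (auto simp: zero_less_mult_iff zero_less_divide_iff)
  ultimately show "raise x \<alpha> j z = raise x \<alpha> j y"
    using raise_scale[OF assms(1,2)] by metis
qed

text \<open>Contracting with the covector of a nonzero vector in the kernel of \<open>\<alpha>\<close> kills the left-hand
  side. In dimension 1, where there is no such vector, the divergence vanishes by homogeneity.\<close>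

lemma raise_radial_imp_0:
  assumes "x \<in> U" "\<alpha> l \<noteq> 0" "r \<noteq> 0"
    and eq: "\<And>y i. y \<noteq> 0 \<Longrightarrow> c * raise x \<alpha> i y = r * y $ i * d * (\<Sum>j\<in>UNIV. pd j (raise x \<alpha> j) y)"
  shows "c = 0"
proof -
  obtain y where y: "y \<noteq> 0" "d * (\<Sum>j\<in>UNIV. pd j (raise x \<alpha> j) y) = 0"
  proof (cases "\<exists>i j :: 'n. i \<noteq> j")
    case True
    then obtain y :: "real ^ 'n" where y: "y \<noteq> 0" "(\<Sum>l\<in>UNIV. \<alpha> l * y $ l) = 0"
      using ex_kernel_vector by blast
    define D where "D = d * (\<Sum>j\<in>UNIV. pd j (raise x \<alpha> j) y)"
    have "c * (\<Sum>j\<in>UNIV. (\<Sum>i\<in>UNIV. fund_tensor L j i x y * raise x \<alpha> i y) * y $ j)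
        = (\<Sum>j\<in>UNIV. \<Sum>i\<in>UNIV. fund_tensor L j i x y * (c * raise x \<alpha> i y) * y $ j)"
      by (simp add: sum_distrib_left sum_distrib_right algebra_simps)
    also have "\<dots> = r * D * (\<Sum>j\<in>UNIV. \<Sum>i\<in>UNIV. fund_tensor L j i x y * y $ j * y $ i)"
      unfolding eq[OF y(1)] D_def by (simp add: sum_distrib_left sum_distrib_right algebra_simps)
    finally have "r * D * (\<Sum>j\<in>UNIV. \<Sum>i\<in>UNIV. fund_tensor L j i x y * y $ j * y $ i) = 0"
      using y(2) by (simp add: lower_raise[OF assms(1) y(1)])
    \<comment> \<open>The double sum is \<open>g_y(y, y)\<close>, which is positive because
      \<open>y\<close> is nonzero.\<close>
    then have "D = 0" using pos_def[OF assms(1) y(1) y(1)] assms(3) by simp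
    then show ?thesis using y(1) by (intro that) (simp_all add: D_def)
  next
    case False
    have y: "axis l 1 \<noteq> (0 :: real ^ 'n)" by (simp add: axis_eq_0_iff)
    have "pd j (raise x \<alpha> j) (axis l 1) = 0" for j
    proof (rule pd_raise_dim_1[OF assms(1) y])
      fix i j :: 'n
      show "i = j"
      proof (rule ccontr)
        assume "i \<noteq> j"
        with False show False by blast
      qed
    qed
    then show ?thesis by (intro that[OF y]) simp
  qed
  have "c * raise x \<alpha> i y = 0" for i
    using eq[OF y(1), of i] y(2) by (simp add: mult.assoc)
  \<comment> \<open>Lowering the index again recovers \<open>\<alpha>\<close>, whose component
    \<open>l\<close> is nonzero.\<close>
  moreover have "\<exists>i. raise x \<alpha> i y \<noteq> 0"
  proof (rule ccontr)
    assume "\<nexists>i. raise x \<alpha> i y \<noteq> 0"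
    then show False using lower_raise[OF assms(1) y(1), of l \<alpha>] assms(2) by simp
  qed
  ultimately show ?thesis by auto
qed

end

section \<open>Coordinates split into two blocks\<close>

locale splitting =
  fixes \<iota> :: "'n::finite \<Rightarrow> 'k::finite" and \<kappa> :: "'m::finite \<Rightarrow> 'k"
  assumes inj_\<iota>: "inj \<iota>" and inj_\<kappa>: "inj \<kappa>"
    and disjoint: "\<iota> i \<noteq> \<kappa> a"
    and cover: "(\<exists>i. k = \<iota> i) \<or> (\<exists>a. k = \<kappa> a)"
begin

definition join :: "real ^ 'n \<Rightarrow> real ^ 'm \<Rightarrow> real ^ 'k" where
  "join x u = (\<chi> k. if k \<in> range \<iota> then x $ inv \<iota> k else u $ inv \<kappa> k)"

lemma join_\<iota> [simp]: "join x u $ \<iota> i = x $ i"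
  by (simp add: join_def inj_\<iota>)

lemma join_\<kappa> [simp]: "join x u $ \<kappa> a = u $ a"
proof -
  have "\<kappa> a \<notin> range \<iota>" using disjoint by (metis imageE)
  then show ?thesis by (simp add: join_def inj_\<kappa>)
qed

lemma eq_simps [simp]:
  "\<iota> i = \<iota> j \<longleftrightarrow> i = j" "\<kappa> a = \<kappa> b \<longleftrightarrow> a = b" "\<iota> i \<noteq> \<kappa> a" "\<kappa> a \<noteq> \<iota> i"
  using inj_\<iota> inj_\<kappa> disjoint by (simp_all add: inj_eq) metis

lemma all_split: "(\<forall>k. P k) \<longleftrightarrow> (\<forall>i. P (\<iota> i)) \<and> (\<forall>a. P (\<kappa> a))"
  using cover by metis

lemma vec_eq_split: "z = w \<longleftrightarrow> (\<forall>i. z $ \<iota> i = w $ \<iota> i) \<and> (\<forall>a. z $ \<kappa> a = w $ \<kappa> a)"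
  by (simp add: vec_eq_iff all_split)

lemma sum_split:
  fixes f :: "'k \<Rightarrow> 'a::comm_monoid_add"
  shows "(\<Sum>k\<in>UNIV. f k) = (\<Sum>i\<in>UNIV. f (\<iota> i)) + (\<Sum>a\<in>UNIV. f (\<kappa> a))"
proof -
  have "k \<in> range \<iota> \<union> range \<kappa>" for k using cover[of k] by auto
  then have "UNIV = range \<iota> \<union> range \<kappa>" by auto
  then have "(\<Sum>k\<in>UNIV. f k) = sum f (range \<iota> \<union> range \<kappa>)" by simp
  also have "\<dots> = sum f (range \<iota>) + sum f (range \<kappa>)"
    by (rule sum.union_disjoint) auto
  also have "\<dots> = (\<Sum>i\<in>UNIV. f (\<iota> i)) + (\<Sum>a\<in>UNIV. f (\<kappa> a))"
    by (simp add: sum.reindex inj_\<iota> inj_\<kappa>)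
  finally show ?thesis .
qed

lemma pd_\<iota>: "pd (\<iota> i) h (join y v) = pd i (\<lambda>y. h (join y v)) y"
proof -
  have "join y v + t *\<^sub>R axis (\<iota> i) 1 = join (y + t *\<^sub>R axis i 1) v" for t
    by (simp add: vec_eq_split axis_def)
  then show ?thesis by (simp add: pd_def)
qed

lemma pd_\<kappa>: "pd (\<kappa> a) h (join y v) = pd a (\<lambda>v. h (join y v)) v"
proof -
  have "join y v + t *\<^sub>R axis (\<kappa> a) 1 = join y (v + t *\<^sub>R axis a 1)" for t
    by (simp add: vec_eq_split axis_def)
  then show ?thesis by (simp add: pd_def)
qed

definition proj1 :: "real ^ 'k \<Rightarrow> real ^ 'n" where "proj1 z = (\<chi> i. z $ \<iota> i)"
definition proj2 :: "real ^ 'k \<Rightarrow> real ^ 'm" where "proj2 z = (\<chi> a. z $ \<kappa> a)"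

lemma join_proj [simp]: "join (proj1 z) (proj2 z) = z"
  by (simp add: vec_eq_split proj1_def proj2_def)

lemma proj_join [simp]: "proj1 (join x u) = x" "proj2 (join x u) = u"
  by (simp_all add: proj1_def proj2_def vec_eq_iff)

lemma bounded_linear_proj: "bounded_linear proj1" "bounded_linear proj2"
  by (auto simp: linear_conv_bounded_linear[symmetric] proj1_def proj2_def vec_eq_iff intro!: linearI)

lemma bounded_linear_join: "bounded_linear (\<lambda>(x, u). join x u)"
  by (auto simp: linear_conv_bounded_linear[symmetric] vec_eq_split intro!: linearI)

lemma has_derivative_join:
  assumes "(f has_derivative f') (at x)" "(g has_derivative g') (at x)"
  shows "((\<lambda>z. join (f z) (g z)) has_derivative (\<lambda>h. join (f' h) (g' h))) (at x)"
proof -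
  have "((\<lambda>z. (f z, g z)) has_derivative (\<lambda>h. (f' h, g' h))) (at x)"
    using assms by (rule has_derivative_Pair)
  from bounded_linear.has_derivative[OF bounded_linear_join this] show ?thesis by simp
qed

text \<open>This symmetry is the reason for two abstract injections into \<open>'k\<close> in place
  of a sum type: exchanging the factors keeps the index type, so each fact about the block
  \<open>\<iota>\<close> has a mirror image for \<open>\<kappa>\<close>.\<close>

lemma splitting_flip: "splitting \<kappa> \<iota>"
proof unfold_locales
  show "(\<exists>a. k = \<kappa> a) \<or> (\<exists>i. k = \<iota> i)" for k using cover[of k] by blast
qed (simp_all add: inj_\<iota> inj_\<kappa>)

text \<open>The exchanged locale takes the blocks in the opposite order but assembles the same
  vector, so mirrored facts speak of the same \<open>L\<close>.\<close>

lemma join_flip: "splitting.join \<kappa> \<iota> u x = join x u"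
proof -
  interpret flip: splitting \<kappa> \<iota> by (rule splitting_flip)
  show ?thesis
    by (simp only: vec_eq_split join_\<iota> join_\<kappa> flip.join_\<iota> flip.join_\<kappa> simp_thms)
qed

lemma matrix_inv_block:
  fixes A :: "real ^ 'k ^ 'k" and A1 :: "real ^ 'n ^ 'n" and A2 :: "real ^ 'm ^ 'm"
  assumes "\<And>i j. A $ \<iota> i $ \<iota> j = s * A1 $ i $ j" "\<And>a b. A $ \<kappa> a $ \<kappa> b = r * A2 $ a $ b"
    and "\<And>i a. A $ \<iota> i $ \<kappa> a = 0" "\<And>i a. A $ \<kappa> a $ \<iota> i = 0"
    and "det A1 \<noteq> 0" "det A2 \<noteq> 0" "s \<noteq> 0" "r \<noteq> 0"
  shows "matrix_inv A $ \<iota> i $ \<iota> j = matrix_inv A1 $ i $ j / s"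
    and "matrix_inv A $ \<iota> i $ \<kappa> a = 0"
proof -
  let ?B1 = "matrix_inv A1" and ?B2 = "matrix_inv A2"
  \<comment> \<open>The expected inverse is block diagonal; joining with 0 supplies the off-diagonal
    blocks.\<close>
  define B :: "real ^ 'k ^ 'k" where
    "B = (\<chi> k. join (\<chi> j. join (column j ?B1 /\<^sub>R s) 0 $ k) (\<chi> b. join 0 (column b ?B2 /\<^sub>R r) $ k))"
  have B: "B $ \<iota> i $ \<iota> j = ?B1 $ i $ j / s" "B $ \<kappa> a $ \<kappa> b = ?B2 $ a $ b / r"
    "B $ \<iota> i $ \<kappa> a = 0" "B $ \<kappa> a $ \<iota> i = 0" for i j a b
    by (simp_all add: B_def column_def divide_inverse mult.commute)
  have I1: "(\<Sum>l\<in>UNIV. A1 $ i $ l * ?B1 $ l $ j) = (if i = j then 1 else 0)" for i j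
    using arg_cong[OF matrix_inv_right_det[OF assms(5)], of "\<lambda>M. M $ i $ j"]
    by (simp add: matrix_matrix_mult_def mat_def)
  have I2: "(\<Sum>l\<in>UNIV. A2 $ i $ l * ?B2 $ l $ j) = (if i = j then 1 else 0)" for i j
    using arg_cong[OF matrix_inv_right_det[OF assms(6)], of "\<lambda>M. M $ i $ j"]
    by (simp add: matrix_matrix_mult_def mat_def)
  have "A ** B = mat 1"
    unfolding vec_eq_iff all_split
    using assms(7,8) by (simp add: matrix_matrix_mult_def sum_split assms(1-4) B I1 I2 mat_def)
  then have "matrix_inv A = B" by (rule matrix_inv_eqI)
  then show "matrix_inv A $ \<iota> i $ \<iota> j = ?B1 $ i $ j / s" "matrix_inv A $ \<iota> i $ \<kappa> a = 0"
    by (simp_all add: B)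
qed

end

section \<open>The doubly warped product in coordinates\<close>

locale dwp_local = splitting \<iota> \<kappa> + M1: finsler_local U L1 + M2: finsler_local V L2
  for \<iota> :: "'n::finite \<Rightarrow> 'k::finite" and \<kappa> :: "'m::finite \<Rightarrow> 'k"
    and U :: "(real ^ 'n) set" and L1 and V :: "(real ^ 'm) set" and L2 +
  fixes q1 :: "real ^ 'n \<Rightarrow> real" and q2 :: "real ^ 'm \<Rightarrow> real"
    and L :: "real ^ 'k \<Rightarrow> real ^ 'k \<Rightarrow> real"
  assumes smooth_q1: "smooth_on U q1" and smooth_q2: "smooth_on V q2"
    and q1_pos: "\<And>x. x \<in> U \<Longrightarrow> q1 x > 0" and q2_pos: "\<And>u. u \<in> V \<Longrightarrow> q2 u > 0"
    and L_join: "\<And>x u y v. x \<in> U \<Longrightarrow> u \<in> V \<Longrightarrow>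
      (L (join x u) (join y v))\<^sup>2 = q2 u * M1.H x y + q1 x * M2.H u v"
begin

text \<open>\<open>q1\<close> and \<open>q2\<close> stand for the squares of \<open>f_1\<close> and
  \<open>f_2\<close>. The locale constrains only the square of \<open>L\<close>, since all tensors
  below depend on \<open>L\<close> through it. These assumptions are symmetric in the two
  factors.\<close>

lemma flip: "dwp_local \<kappa> \<iota> V L2 U L1 q2 q1 L"
proof -
  interpret flip: splitting \<kappa> \<iota> by (rule splitting_flip)
  show ?thesis
    by unfold_locales (simp_all add: smooth_q1 smooth_q2 q1_pos q2_pos join_flip L_join)
qed

lemma pd_L_\<iota>:
  assumes "x \<in> U" "u \<in> V" "y \<noteq> 0"
  shows "pd (\<iota> l) (\<lambda>z. (L (join x u) z)\<^sup>2) (join y v) = q2 u * pd l (M1.H x) y"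
  unfolding pd_\<iota>
  using pd_lin2[OF open_slit _ M1.smooth_H_snd[OF assms(1)] smooth_on_const[of _ 1],
      of y "\<lambda>y. (L (join x u) (join y v))\<^sup>2" "q2 u" "q1 x * M2.H u v" l] assms
  by (simp add: L_join pd_const)

lemma pd_pd_L_\<iota>:
  assumes "x \<in> U" "u \<in> V" "y \<noteq> 0"
  shows "pd (\<iota> i) (pd (\<iota> l) (\<lambda>z. (L (join x u) z)\<^sup>2)) (join y v) = q2 u * pd i (pd l (M1.H x)) y"
    and "pd (\<kappa> a) (pd (\<iota> l) (\<lambda>z. (L (join x u) z)\<^sup>2)) (join y v) = 0"
proof -
  show "pd (\<iota> i) (pd (\<iota> l) (\<lambda>z. (L (join x u) z)\<^sup>2)) (join y v) = q2 u * pd i (pd l (M1.H x)) y"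
    unfolding pd_\<iota>[of i]
    by (rule pd_lin1[OF open_slit _ smooth_on_pd[OF open_slit M1.smooth_H_snd]])
      (use assms in \<open>auto simp: pd_L_\<iota>\<close>)
  show "pd (\<kappa> a) (pd (\<iota> l) (\<lambda>z. (L (join x u) z)\<^sup>2)) (join y v) = 0"
    unfolding pd_\<kappa>[of a] using assms by (simp add: pd_L_\<iota> pd_const)
qed

lemma fund_tensor_\<iota>:
  assumes "x \<in> U" "u \<in> V" "y \<noteq> 0"
  shows "fund_tensor L (\<iota> i) (\<iota> j) (join x u) (join y v) = q2 u * fund_tensor L1 i j x y"
    and "fund_tensor L (\<kappa> a) (\<iota> j) (join x u) (join y v) = 0"
  using pd_pd_L_\<iota>[OF assms] by (simp_all add: fund_tensor_pd)

lemma fund_tensor_\<kappa>: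
  assumes "x \<in> U" "u \<in> V" "v \<noteq> 0"
  shows "fund_tensor L (\<kappa> a) (\<kappa> b) (join x u) (join y v) = q1 x * fund_tensor L2 a b u v"
    and "fund_tensor L (\<iota> i) (\<kappa> b) (join x u) (join y v) = 0"
  using dwp_local.fund_tensor_\<iota>[OF flip assms(2,1,3)] by (simp_all add: join_flip)

lemma fund_inverse_\<iota>:
  assumes "x \<in> U" "u \<in> V" "y \<noteq> 0" "v \<noteq> 0"
  shows "fund_inverse L (\<iota> i) (\<iota> j) (join x u) (join y v) = fund_inverse L1 i j x y / q2 u"
    and "fund_inverse L (\<iota> i) (\<kappa> a) (join x u) (join y v) = 0"
  unfolding fund_inverse_def
  by (rule matrix_inv_block[of _ "q2 u" "M1.G x y" "q1 x" "M2.G u v"];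
      use assms q1_pos[of x] q2_pos[of u] in
      \<open>simp add: fund_tensor_\<iota> fund_tensor_\<kappa> M1.det_G M2.det_G\<close>)+

text \<open>Entries of the fundamental tensor with second index \<open>\<iota> j\<close> are zero or
  \<open>q2\<close> times those of the first factor, hence free of \<open>v\<close>. What remains
  are the third derivatives in \<open>y\<close> that are assumed to vanish.\<close>

lemma cartan_torsion_\<iota>:
  assumes "x \<in> U" "u \<in> V" "y \<noteq> 0" "v \<noteq> 0"
    and "\<And>i j k. pd k (pd i (pd j (M1.H x))) y = 0"
  shows "cartan_torsion L k (\<iota> j) l (join x u) (join y v) = 0"
proof -
  have *: "\<forall>l k. cartan_torsion L k (\<iota> j) l (join x u) (join y v) = 0"
  proof (unfold all_split, intro conjI allI)
    fix i l a b
    have "pd l (\<lambda>y. fund_tensor L (\<iota> i) (\<iota> j) (join x u) (join y v)) y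
        = q2 u / 2 * pd l (pd i (pd j (M1.H x))) y"
      by (rule pd_lin1[OF open_slit])
        (use assms in \<open>auto simp: pd_pd_L_\<iota> fund_tensor_pd
           intro!: smooth_on_pd open_slit M1.smooth_H_snd\<close>)
    then show "cartan_torsion L (\<iota> i) (\<iota> j) (\<iota> l) (join x u) (join y v) = 0"
      by (simp add: cartan_torsion_def dy_pd pd_\<iota> assms(5))
    have "pd l (\<lambda>y. fund_tensor L (\<kappa> a) (\<iota> j) (join x u) (join y v)) y = 0"
      by (rule pd_eq_0[OF open_slit]) (use assms in \<open>auto simp: fund_tensor_\<iota>\<close>)
    then show "cartan_torsion L (\<kappa> a) (\<iota> j) (\<iota> l) (join x u) (join y v) = 0"
      by (simp add: cartan_torsion_def dy_pd pd_\<iota>)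
    show "cartan_torsion L (\<iota> i) (\<iota> j) (\<kappa> b) (join x u) (join y v) = 0"
      "cartan_torsion L (\<kappa> a) (\<iota> j) (\<kappa> b) (join x u) (join y v) = 0"
      using assms by (simp_all add: cartan_torsion_def dy_pd pd_\<kappa> fund_tensor_\<iota> pd_const)
  qed
  then show ?thesis by blast
qed

lemma cartan_torsion_\<kappa>:
  assumes "x \<in> U" "u \<in> V" "y \<noteq> 0" "v \<noteq> 0"
    and "\<And>a b c. pd c (pd a (pd b (M2.H u))) v = 0"
  shows "cartan_torsion L k (\<kappa> b) l (join x u) (join y v) = 0"
  using dwp_local.cartan_torsion_\<iota>[OF flip assms(2,1,4,3), of k b l] assms(5) by (simp add: join_flip)

text \<open>The inverse has no mixed block, so only \<open>l\<close> in the first factor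
  contributes. There the terms with \<open>q2\<close> undifferentiated give the spray of
  \<open>L1\<close>, the variation of \<open>q2\<close> along \<open>v\<close> gives the second
  term, and the derivative of \<open>q1\<close> in the subtracted \<open>dx\<close> gives the
  last.\<close>

lemma spray_coeff_\<iota>:
  assumes "x \<in> U" "u \<in> V" "y \<noteq> 0" "v \<noteq> 0"
  shows "spray_coeff L (\<iota> i) (join x u) (join y v) = spray_coeff L1 i x y
    + (\<Sum>c\<in>UNIV. pd c q2 u * v $ c) * (1 / (4 * q2 u) * M1.raise x (\<lambda>l. pd l (M1.H x) y) i y)
    - M2.H u v * M1.raise x (\<lambda>l. pd l q1 x / (4 * q2 u)) i y"
proof -
  have 1: "pd (\<iota> k) (\<lambda>x. pd (\<iota> l) (\<lambda>z. (L x z)\<^sup>2) (join y v)) (join x u)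
      = q2 u * pd k (\<lambda>x. pd l (M1.H x) y) x" for k l
    unfolding pd_\<iota>[of k]
    by (rule pd_lin1[OF M1.open_U _ M1.smooth_pd_H_fst]) (use assms in \<open>auto simp: pd_L_\<iota>\<close>)
  have 2: "pd (\<kappa> c) (\<lambda>x. pd (\<iota> l) (\<lambda>z. (L x z)\<^sup>2) (join y v)) (join x u)
      = pd l (M1.H x) y * pd c q2 u" for c l
    unfolding pd_\<kappa>[of c]
    by (rule pd_lin1[OF M2.open_U _ smooth_q2]) (use assms in \<open>auto simp: pd_L_\<iota>\<close>)
  have 3: "pd (\<iota> l) (\<lambda>x. (L x (join y v))\<^sup>2) (join x u)
      = q2 u * pd l (\<lambda>x. M1.H x y) x + M2.H u v * pd l q1 x" for l
    unfolding pd_\<iota>[of l]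
    by (rule pd_lin2[OF M1.open_U _ M1.smooth_H_fst smooth_q1]) (use assms in \<open>auto simp: L_join\<close>)
  define g where "g l = fund_inverse L1 i l x y" for l
  define P where "P l = (\<Sum>k\<in>UNIV. pd k (\<lambda>x. pd l (M1.H x) y) x * y $ k)" for l
  define \<phi> where "\<phi> = (\<Sum>c\<in>UNIV. pd c q2 u * v $ c)"
  have "spray_coeff L (\<iota> i) (join x u) (join y v) =
     1/4 * (\<Sum>l\<in>UNIV. g l / q2 u * (q2 u * P l + \<phi> * pd l (M1.H x) y
       - (q2 u * pd l (\<lambda>x. M1.H x y) x + M2.H u v * pd l q1 x)))"
    by (simp add: spray_coeff_pd sum_split fund_inverse_\<iota>[OF assms] 1 2 3 g_def P_def \<phi>_def
        sum_distrib_left sum_distrib_right mult_ac)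
  also have "\<dots> = (\<Sum>l\<in>UNIV. 1/4 * (g l * (P l - pd l (\<lambda>x. M1.H x y) x))
      + \<phi> * (1 / (4 * q2 u) * (g l * pd l (M1.H x) y)) - M2.H u v * (g l * (pd l q1 x / (4 * q2 u))))"
    using q2_pos[OF assms(2)] unfolding sum_distrib_left
    by (intro sum.cong refl) (simp add: field_simps)
  also have "\<dots> = spray_coeff L1 i x y
    + \<phi> * (1 / (4 * q2 u) * M1.raise x (\<lambda>l. pd l (M1.H x) y) i y)
    - M2.H u v * M1.raise x (\<lambda>l. pd l q1 x / (4 * q2 u)) i y"
    unfolding spray_coeff_pd M1.raise_def sum_distrib_left
    by (simp add: sum.distrib sum_subtractf g_def P_def)
  finally show ?thesis by (simp add: \<phi>_def)
qed


text \<open>The factor 1/4 comes from the spray coefficients and \<open>1 / q2\<close> from the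
  inverse of the first block. Raised with the fundamental tensor of \<open>L1\<close>, this is the
  vector \<open>K\<close> of the outline.\<close>

definition covector :: "real ^ 'n \<Rightarrow> real ^ 'm \<Rightarrow> 'n \<Rightarrow> real" where
  "covector x u l = pd l q1 x / (4 * q2 u)"

text \<open>With \<open>x\<close> and \<open>u\<close> fixed, \<open>v\<close> enters through a
  constant, a linear form and \<open>F_2^2\<close>; the coefficients are smooth in \<open>y\<close>,
  ready to be differentiated.\<close>

lemma spray_coeff_form_\<iota>:
  assumes "x \<in> U" "u \<in> V"
  obtains A Y where "\<And>i. smooth_on (UNIV - {0}) (A i)" "\<And>i. smooth_on (UNIV - {0}) (Y i)"
    and "\<And>i y v. \<lbrakk>y \<noteq> 0; v \<noteq> 0\<rbrakk> \<Longrightarrow> spray_coeff L (\<iota> i) (join x u) (join y v) =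
      A i y + (\<Sum>c\<in>UNIV. pd c q2 u * v $ c) * Y i y - M2.H u v * M1.raise x (covector x u) i y"
proof
  show "smooth_on (UNIV - {0}) (spray_coeff L1 i x)" for i
    using M1.smooth_spray_coeff[OF assms(1)] .
  show "smooth_on (UNIV - {0}) (\<lambda>y. 1 / (4 * q2 u) * M1.raise x (\<lambda>l. pd l (M1.H x) y) i y)" for i
    unfolding M1.raise_def
    by (intro smooth_on_cmult smooth_on_sum smooth_on_mult M1.smooth_fund_inverse assms open_slit
        smooth_on_pd M1.smooth_H_snd)
  show "spray_coeff L (\<iota> i) (join x u) (join y v) = spray_coeff L1 i x y
      + (\<Sum>c\<in>UNIV. pd c q2 u * v $ c) * (1 / (4 * q2 u) * M1.raise x (\<lambda>l. pd l (M1.H x) y) i y)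
      - M2.H u v * M1.raise x (covector x u) i y" if "y \<noteq> 0" "v \<noteq> 0" for i y v
    unfolding covector_def using spray_coeff_\<iota>[OF assms that] .
qed

text \<open>The mirror image: here \<open>y\<close> enters through a constant, a linear form and
  \<open>F_1^2\<close>, of degrees 0, 1 and 2, which the later rescaling of \<open>y\<close> tells
  apart.\<close>

lemma spray_coeff_form_\<kappa>:
  assumes "x \<in> U" "u \<in> V"
  obtains B Z Q where "\<And>a. smooth_on (UNIV - {0}) (B a)" "\<And>a. smooth_on (UNIV - {0}) (Z a)"
    and "\<And>a. smooth_on (UNIV - {0}) (Q a)"
    and "\<And>a y v. \<lbrakk>y \<noteq> 0; v \<noteq> 0\<rbrakk> \<Longrightarrow> spray_coeff L (\<kappa> a) (join x u) (join y v) =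
      B a v + (\<Sum>c\<in>UNIV. pd c q1 x * y $ c) * Z a v - M1.H x y * Q a v"
proof -
  interpret flip: dwp_local \<kappa> \<iota> V L2 U L1 q2 q1 L by (rule flip)
  show thesis
  proof (rule flip.spray_coeff_form_\<iota>[OF assms(2,1), unfolded join_flip])
    fix B Z
    assume *: "\<And>a. smooth_on (UNIV - {0}) (B a)" "\<And>a. smooth_on (UNIV - {0}) (Z a)"
      "\<And>a v y. \<lbrakk>v \<noteq> 0; y \<noteq> 0\<rbrakk> \<Longrightarrow> spray_coeff L (\<kappa> a) (join x u) (join y v) =
        B a v + (\<Sum>c\<in>UNIV. pd c q1 x * y $ c) * Z a v
        - M1.H x y * M2.raise u (flip.covector u x) a v"
    show thesis
      by (rule that[OF *(1,2) M2.smooth_raise[OF assms(2)] *(3)])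
  qed
qed

text \<open>Two derivatives in \<open>v\<close> already remove the constant and the linear term, so
  only the coefficient of \<open>F_2^2\<close> is left for the third.\<close>

lemma berwald_\<iota>\<kappa>:
  assumes "x \<in> U" "u \<in> V" "y \<noteq> 0" "v \<noteq> 0"
  shows "berwald L (\<iota> i) (\<kappa> a) (\<kappa> b) (\<kappa> c) (join x u) (join y v) =
    - M1.raise x (covector x u) i y * pd a (pd b (pd c (M2.H u))) v"
proof -
  obtain A Y where AY: "\<And>i y v. \<lbrakk>y \<noteq> 0; v \<noteq> 0\<rbrakk> \<Longrightarrow> spray_coeff L (\<iota> i) (join x u) (join y v) =
      A i y + (\<Sum>c\<in>UNIV. pd c q2 u * v $ c) * Y i y - M2.H u v * M1.raise x (covector x u) i y"
    by (rule spray_coeff_form_\<iota>[OF assms(1,2)]) (rule that)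
  let ?g = "\<lambda>v. spray_coeff L (\<iota> i) (join x u) (join y v)"
  have *: "pd b (pd c ?g) v = - M1.raise x (covector x u) i y * pd b (pd c (M2.H u)) v" if "v \<noteq> 0" for v
    by (rule pd_pd_affine_add[OF M2.smooth_H_snd[OF assms(2)] that]) (rule AY[OF assms(3)])
  have "pd a (pd b (pd c ?g)) v = - M1.raise x (covector x u) i y * pd a (pd b (pd c (M2.H u))) v"
    by (rule pd_lin1[OF open_slit _ smooth_on_pd[OF open_slit smooth_on_pd[OF open_slit M2.smooth_H_snd]]])
      (use assms in \<open>auto simp: *\<close>)
  then show ?thesis by (simp add: berwald_def dy_pd pd_\<kappa>)
qed

text \<open>The mean Berwald curvature in the directions of the second factor is a sum of four products
  of a function of \<open>y\<close> and a function of \<open>v\<close>. The functions of \<open>y\<close> are homogeneous of the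
  different degrees \<open>-1\<close>, \<open>0\<close>, \<open>1\<close> and \<open>2\<close>.\<close>

lemma dy_mean_berwald_\<kappa>:
  assumes "x \<in> U" "u \<in> V" "v \<noteq> 0"
  obtains P1 P2 P3 where "\<And>y. y \<noteq> 0 \<Longrightarrow>
    dy (\<kappa> c) (mean_berwald L (\<kappa> a) (\<kappa> b)) (join x u) (join y v) =
      - (1/2) * (\<Sum>i\<in>UNIV. pd i (M1.raise x (covector x u) i) y) * pd c (pd a (pd b (M2.H u))) v
      + P1 + (\<Sum>k\<in>UNIV. pd k q1 x * y $ k) * P2 - M1.H x y * P3"
proof -
  obtain A Y where smooth_AY: "\<And>i. smooth_on (UNIV - {0}) (A i)" "\<And>i. smooth_on (UNIV - {0}) (Y i)"
    and AY: "\<And>i y v. \<lbrakk>y \<noteq> 0; v \<noteq> 0\<rbrakk> \<Longrightarrow> spray_coeff L (\<iota> i) (join x u) (join y v) =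
      A i y + (\<Sum>c\<in>UNIV. pd c q2 u * v $ c) * Y i y - M2.H u v * M1.raise x (covector x u) i y"
    by (rule spray_coeff_form_\<iota>[OF assms(1,2)]) (rule that)
  obtain B Z Q where smooth_BZQ: "\<And>a. smooth_on (UNIV - {0}) (B a)" "\<And>a. smooth_on (UNIV - {0}) (Z a)"
      "\<And>a. smooth_on (UNIV - {0}) (Q a)"
    and BZQ: "\<And>a y v. \<lbrakk>y \<noteq> 0; v \<noteq> 0\<rbrakk> \<Longrightarrow> spray_coeff L (\<kappa> a) (join x u) (join y v) =
      B a v + (\<Sum>c\<in>UNIV. pd c q1 x * y $ c) * Z a v - M1.H x y * Q a v"
    by (rule spray_coeff_form_\<kappa>[OF assms(1,2)]) (rule that)
  let ?\<psi> = "\<lambda>y. \<Sum>k\<in>UNIV. pd k q1 x * y $ k" and ?K = "M1.raise x (covector x u)"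
  define S where "S C v = (\<Sum>e\<in>UNIV. pd a (pd b (pd e (C e))) v)" for C :: "'m \<Rightarrow> real ^ 'm \<Rightarrow> real" and v
  have smooth_S: "smooth_on (UNIV - {0}) (S C)" if "\<And>e. smooth_on (UNIV - {0}) (C e)" for C
    unfolding S_def by (intro smooth_on_sum smooth_on_pd open_slit that)
  have smooth_H2: "smooth_on (UNIV - {0}) (pd a (pd b (M2.H u)))"
    by (intro smooth_on_pd open_slit M2.smooth_H_snd assms)
  show thesis
  proof
    fix y :: "real ^ 'n" assume y: "y \<noteq> 0"
    define I where "I = (\<Sum>i\<in>UNIV. pd i (?K i) y)"
    \<comment> \<open>Trace over the first factor: the derivative in \<open>y\<close> acts on the
      coefficients alone, so the expression remains affine in \<open>v\<close> plus a multiple of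
      \<open>F_2^2\<close>.\<close>
    have 1: "pd a (pd b (\<lambda>v. pd (\<iota> i) (spray_coeff L (\<iota> i) (join x u)) (join y v))) v
        = - pd i (?K i) y * pd a (pd b (M2.H u)) v" if "v \<noteq> 0" for i v
    proof (rule pd_pd_affine_add[OF M2.smooth_H_snd[OF assms(2)] that])
      fix v :: "real ^ 'm" assume v: "v \<noteq> 0"
      show "pd (\<iota> i) (spray_coeff L (\<iota> i) (join x u)) (join y v)
          = pd i (A i) y + (\<Sum>c\<in>UNIV. pd c q2 u * v $ c) * pd i (Y i) y - M2.H u v * pd i (?K i) y"
        unfolding pd_\<iota>
        using pd_lin3[OF open_slit _ smooth_AY M1.smooth_raise[OF assms(1)], of y
            "\<lambda>y. spray_coeff L (\<iota> i) (join x u) (join y v)" 1 i "\<Sum>c\<in>UNIV. pd c q2 u * v $ c" i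
            "- M2.H u v" "covector x u" i i] y v
        by (simp add: AY)
    qed
    \<comment> \<open>Trace over the second factor: all three derivatives act on \<open>v\<close>,
      so \<open>y\<close> enters only through 1, \<open>?\<psi> y\<close> and
      \<open>M1.H x y\<close>.\<close>
    have 2: "pd a (pd b (\<lambda>v. pd (\<kappa> e) (spray_coeff L (\<kappa> e) (join x u)) (join y v))) v
        = 1 * pd a (pd b (pd e (B e))) v + ?\<psi> y * pd a (pd b (pd e (Z e))) v
          + (- M1.H x y) * pd a (pd b (pd e (Q e))) v" if "v \<noteq> 0" for e v
      unfolding pd_\<kappa>
      by (rule pd_lin3[OF open_slit]; (intro smooth_on_pd open_slit smooth_BZQ)?; (use that in simp; fail)?)+
        (use y in \<open>simp add: BZQ\<close>)
    have mb: "mean_berwald L (\<kappa> a) (\<kappa> b) (join x u) (join y v) =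
        (- I / 2) * pd a (pd b (M2.H u)) v + (1/2) * S B v + (1/2 * ?\<psi> y) * S Z v
        + (- (1/2) * M1.H x y) * S Q v" if "v \<noteq> 0" for v
    proof -
      have "(\<Sum>i\<in>UNIV. - pd i (?K i) y * pd a (pd b (M2.H u)) v) = - I * pd a (pd b (M2.H u)) v"
        by (simp add: I_def sum_negf flip: sum_distrib_right)
      moreover have "(\<Sum>e\<in>UNIV. 1 * pd a (pd b (pd e (B e))) v + ?\<psi> y * pd a (pd b (pd e (Z e))) v
          + (- M1.H x y) * pd a (pd b (pd e (Q e))) v) = S B v + ?\<psi> y * S Z v + (- M1.H x y) * S Q v"
        by (simp add: S_def sum.distrib sum_subtractf flip: sum_distrib_left)
      ultimately show ?thesis
        unfolding mean_berwald_pd sum_split pd_\<kappa>[of a] pd_\<kappa>[of b] 1[OF that] 2[OF that]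
        by (simp add: algebra_simps)
    qed
    have "dy (\<kappa> c) (mean_berwald L (\<kappa> a) (\<kappa> b)) (join x u) (join y v) =
        (- I / 2) * pd c (pd a (pd b (M2.H u))) v + (1/2) * pd c (S B) v + (1/2 * ?\<psi> y) * pd c (S Z) v
        + (- (1/2) * M1.H x y) * pd c (S Q) v"
      unfolding dy_pd pd_\<kappa>
      by (rule pd_lin4[OF open_slit _ smooth_H2 smooth_S smooth_S smooth_S])
        (use assms(3) in \<open>auto simp: smooth_BZQ mb\<close>)
    then show "dy (\<kappa> c) (mean_berwald L (\<kappa> a) (\<kappa> b)) (join x u) (join y v) =
      - (1/2) * I * pd c (pd a (pd b (M2.H u))) v
      + 1/2 * pd c (S B) v + ?\<psi> y * (1/2 * pd c (S Z) v) - M1.H x y * (1/2 * pd c (S Q) v)"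
      by simp
  qed
qed

text \<open>Rescaling \<open>y\<close> isolates the part of the Douglas curvature of lowest degree in \<open>y\<close>.\<close>

lemma third_derivative_eq_0:
  assumes "x \<in> U" "u \<in> V" "v \<noteq> 0" "pd l q1 x \<noteq> 0"
    and D: "\<And>i y. y \<noteq> 0 \<Longrightarrow> douglas L (\<iota> i) (\<kappa> a) (\<kappa> b) (\<kappa> c) (join x u) (join y v) = 0"
  shows "pd a (pd b (pd c (M2.H u))) v = 0"
proof -
  let ?K = "M1.raise x (covector x u)" and ?\<psi> = "\<lambda>y. \<Sum>k\<in>UNIV. pd k q1 x * y $ k"
  \<comment> \<open>The first order of differentiation comes from the Berwald curvature, the second
    from the derivative of the mean Berwald curvature. They are kept apart and become the constants
    \<open>c\<close> and \<open>d\<close> of \<open>raise_radial_imp_0\<close>.\<close>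
  let ?\<Phi> = "pd a (pd b (pd c (M2.H u))) v" and ?\<Phi>' = "pd c (pd a (pd b (M2.H u))) v"
  define r where "r = 2 / (real CARD('k) + 1)"
  obtain P1 P2 P3 where P: "\<And>y. y \<noteq> 0 \<Longrightarrow>
    dy (\<kappa> c) (mean_berwald L (\<kappa> a) (\<kappa> b)) (join x u) (join y v) =
      - (1/2) * (\<Sum>i\<in>UNIV. pd i (?K i) y) * ?\<Phi>' + P1 + ?\<psi> y * P2 - M1.H x y * P3"
    by (rule dy_mean_berwald_\<kappa>[OF assms(1-3)]) (rule that)
  \<comment> \<open>The upper index lies in the first factor and the lower ones in the second, so
    all Kronecker symbols vanish and the only correction left is the one along
    \<open>y $ i\<close>.\<close>
  have D': "?K i y * ?\<Phi> + r * y $ i * (- (1/2) * (\<Sum>i\<in>UNIV. pd i (?K i) y) * ?\<Phi>' + P1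
      + ?\<psi> y * P2 - M1.H x y * P3) = 0" if "y \<noteq> 0" for i y
  proof -
    have "- ?K i y * ?\<Phi>
        - r * (dy (\<kappa> c) (mean_berwald L (\<kappa> a) (\<kappa> b)) (join x u) (join y v) * y $ i) = 0"
      using D[OF that, of i] unfolding douglas_def berwald_\<iota>\<kappa>[OF assms(1,2) that assms(3)] r_def
      by (simp add: kronecker_def)
    then show ?thesis unfolding P[OF that] by (simp add: algebra_simps)
  qed
  have eq: "?\<Phi> * ?K i y = r / 2 * y $ i * ?\<Phi>' * (\<Sum>i\<in>UNIV. pd i (?K i) y)" if y: "y \<noteq> 0" for i y
  proof -
    let ?I = "\<Sum>i\<in>UNIV. pd i (?K i) y"
    have "?\<Phi> * ?K i y - r / 2 * y $ i * ?\<Phi>' * ?I = 0"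
    proof (rule cubic_eq_0_imp)
      fix t :: real assume t: "t > 0"
      have I: "(\<Sum>i\<in>UNIV. pd i (?K i) (t *\<^sub>R y)) = ?I / t"
        by (simp add: M1.pd_raise_scale[OF assms(1) y t] sum_divide_distrib)
      have \<psi>: "?\<psi> (t *\<^sub>R y) = t * ?\<psi> y"
        by (simp add: sum_distrib_left algebra_simps)
      \<comment> \<open>At \<open>t y\<close> the vector \<open>K\<close> is unchanged, the
        divergence is divided by \<open>t\<close>, and \<open>y $ i\<close>, \<open>?\<psi>\<close>
        and \<open>M1.H x\<close> gain \<open>t\<close>, \<open>t\<close> and \<open>t ^ 2\<close>.
        Hence \<open>D'\<close> becomes a cubic in \<open>t\<close> whose constant term is the one
        to be shown zero.\<close>
      have alg: "\<phi> * k - r / 2 * z * \<phi>' * I + t * (r * z * P1) + t\<^sup>2 * (r * z * p * P2)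
          + t ^ 3 * (- r * z * h\<^sup>2 * P3)
          = k * \<phi> + r * (t * z) * (- (1/2) * (I / t) * \<phi>' + P1 + t * p * P2 - (t * h)\<^sup>2 * P3)"
        for \<phi> \<phi>' k z I p h :: real
        using t by (simp add: field_simps power2_eq_square power3_eq_cube)
      have "t *\<^sub>R y \<noteq> 0" using t y by simp
      from D'[OF this, of i] show "?\<Phi> * ?K i y - r / 2 * y $ i * ?\<Phi>' * ?I + t * (r * y $ i * P1)
          + t\<^sup>2 * (r * y $ i * ?\<psi> y * P2) + t ^ 3 * (- r * y $ i * M1.H x y * P3) = 0"
        unfolding I \<psi> M1.raise_scale[OF assms(1) y t] M1.homogeneous[OF assms(1) t] alg by simp
    qed
    then show ?thesis by simp
  qed
  have "real CARD('k) + 1 > 0" by (intro add_nonneg_pos) auto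
  then have r: "r / 2 \<noteq> 0" by (simp add: r_def)
  have "covector x u l \<noteq> 0" using assms(4) q2_pos[OF assms(2)] by (simp add: covector_def)
  from M1.raise_radial_imp_0[OF assms(1) this r eq] show ?thesis .
qed

end

section \<open>Tangent vectors in charts\<close>

text \<open>The properties of an atlas on which the calculus of tangent vectors rests. For product
  charts they are checked directly from the transitions of the factors.\<close>

locale transition_atlas =
  fixes A :: "('a, 'n::finite) chart set"
  assumes inj_chart: "c \<in> A \<Longrightarrow> inj_on (snd c) (fst c)"
    and open_overlap: "\<lbrakk>c \<in> A; d \<in> A\<rbrakk> \<Longrightarrow> open (snd c ` (fst c \<inter> fst d))"
    and differentiable_transition:
      "\<lbrakk>c \<in> A; d \<in> A; p \<in> fst c; p \<in> fst d\<rbrakk> \<Longrightarrow> (snd d \<circ> chart_inv c) differentiable (at (snd c p))"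
begin

abbreviation transition :: "('a, 'n) chart \<Rightarrow> ('a, 'n) chart \<Rightarrow> 'a \<Rightarrow> real ^ 'n \<Rightarrow> real ^ 'n" where
  "transition c d p \<equiv> frechet_derivative (snd d \<circ> chart_inv c) (at (snd c p))"

lemma chart_inv_chart [simp]: "c \<in> A \<Longrightarrow> p \<in> fst c \<Longrightarrow> chart_inv c (snd c p) = p"
  using inj_chart by simp

lemma transition_has_derivative:
  "\<lbrakk>c \<in> A; d \<in> A; p \<in> fst c; p \<in> fst d\<rbrakk> \<Longrightarrow>
    ((snd d \<circ> chart_inv c) has_derivative transition c d p) (at (snd c p))"
  using differentiable_transition frechet_derivative_works by blast

lemma transition_linear:
  "\<lbrakk>c \<in> A; d \<in> A; p \<in> fst c; p \<in> fst d\<rbrakk> \<Longrightarrow> bounded_linear (transition c d p)"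
  using transition_has_derivative has_derivative_bounded_linear by blast

text \<open>Near \<open>snd c p\<close> the map factors through the chart \<open>d\<close>, and the
  chain rule applies. The cocycle identity and the chart independence of differentials both come
  from this.\<close>

lemma chart_change:
  fixes g :: "'a \<Rightarrow> 'b::real_normed_vector"
  assumes "c \<in> A" "d \<in> A" "p \<in> fst c" "p \<in> fst d"
    and "((g \<circ> chart_inv d) has_derivative g') (at (snd d p))"
  shows "((g \<circ> chart_inv c) has_derivative g' \<circ> transition c d p) (at (snd c p))"
proof (rule has_derivative_transform_within_open[OF _ open_overlap[OF assms(1,2)]])
  have "((g \<circ> chart_inv d) has_derivative g') (at ((snd d \<circ> chart_inv c) (snd c p)))"
    using assms by simp
  from diff_chain_at[OF transition_has_derivative[OF assms(1-4)] this]
  show "((g \<circ> chart_inv d) \<circ> (snd d \<circ> chart_inv c) has_derivative g' \<circ> transition c d p) (at (snd c p))" .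
qed (use assms in auto)

lemma transition_refl: "c \<in> A \<Longrightarrow> p \<in> fst c \<Longrightarrow> transition c c p \<xi> = \<xi>"
proof -
  assume c: "c \<in> A" "p \<in> fst c"
  have "((snd c \<circ> chart_inv c) has_derivative (\<lambda>x. x)) (at (snd c p))"
    by (rule has_derivative_transform_within_open[OF has_derivative_ident open_overlap[OF c(1) c(1)]])
      (use c in auto)
  from fun_cong[OF frechet_derivative_at[OF this], of \<xi>] show ?thesis by simp
qed

lemma transition_trans:
  assumes "c \<in> A" "d \<in> A" "e \<in> A" "p \<in> fst c" "p \<in> fst d" "p \<in> fst e"
  shows "transition d e p (transition c d p \<xi>) = transition c e p \<xi>"
  using frechet_derivative_at[OF chart_change[OF assms(1,2,4,5) transition_has_derivative[OF assms(2,3,5,6)]]]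
  by (metis comp_apply)

end

text \<open>Inverts \<open>tangent_chart c\<close> over the domain of \<open>c\<close>: components
  in one chart are carried to all others, with the value 0 that \<open>tangent_space\<close> demands
  off the charts around \<open>p\<close>.\<close>

definition tvec_of ::
  "('a, 'n::finite) manifold \<Rightarrow> ('a, 'n) chart \<Rightarrow> 'a \<Rightarrow> real ^ 'n \<Rightarrow> ('a, 'n) tvec" where
  "tvec_of M c p \<xi> = (p, \<lambda>d. if d \<in> atlas M \<and> p \<in> fst d
     then frechet_derivative (snd d \<circ> chart_inv c) (at (snd c p)) \<xi> else 0)"

lemma fst_tvec_of [simp]: "fst (tvec_of M c p \<xi>) = p"
  by (simp add: tvec_of_def)

locale charted_manifold = transition_atlas "atlas M" for M :: "('a, 'n::finite) manifold" +
  assumes chart_subset: "c \<in> atlas M \<Longrightarrow> fst c \<subseteq> topspace (mtop M)"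
begin

lemma tvec_of_tangent:
  assumes "c \<in> atlas M" "p \<in> fst c" shows "tvec_of M c p \<xi> \<in> tangent_bundle M"
proof -
  have "p \<in> topspace (mtop M)" using chart_subset[OF assms(1)] assms(2) by blast
  then show ?thesis
    using assms by (simp add: tvec_of_def tangent_bundle_def tangent_space_def transition_trans)
qed

lemma snd_tvec_of: "c \<in> atlas M \<Longrightarrow> p \<in> fst c \<Longrightarrow> snd (tvec_of M c p \<xi>) c = \<xi>"
  by (simp add: tvec_of_def transition_refl)

lemma tvec_of_coordinates:
  assumes "v \<in> tangent_bundle M" "c \<in> atlas M" "fst v \<in> fst c"
  shows "v = tvec_of M c (fst v) (snd v c)"
proof (rule prod_eqI)
  have "snd v d = snd (tvec_of M c (fst v) (snd v c)) d" for d
  proof -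
    have T: "snd v \<in> tangent_space M (fst v)"
      using assms(1) by (auto simp: tangent_bundle_def)
    have "d \<in> atlas M \<and> fst v \<in> fst d \<longrightarrow> snd v d = transition c d (fst v) (snd v c)"
      "\<not> (d \<in> atlas M \<and> fst v \<in> fst d) \<longrightarrow> snd v d = 0"
      using T assms(2,3) unfolding tangent_space_def by blast+
    then show ?thesis by (simp add: tvec_of_def)
  qed
  then show "snd v = snd (tvec_of M c (fst v) (snd v c))" by blast
qed simp

text \<open>A tangent vector is determined by its components in one chart, so
  \<open>tangent_chart c\<close> is injective over the chart domain and \<open>tvec_of\<close>
  evaluates the \<open>inv_into\<close> in \<open>local_rep\<close>.\<close>

lemma local_rep_chart:
  assumes "c \<in> atlas M" "p \<in> fst c"
  shows "local_rep M F c (snd c p) \<xi> = F (tvec_of M c p \<xi>)"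
proof -
  let ?S = "{v \<in> tangent_bundle M. fst v \<in> fst c}"
  have inj: "inj_on (tangent_chart c) ?S"
  proof (rule inj_onI)
    fix v w assume vw: "v \<in> ?S" "w \<in> ?S" "tangent_chart c v = tangent_chart c w"
    then have "fst v = fst w" "snd v c = snd w c"
      using inj_chart[OF assms(1)] by (auto simp: tangent_chart_def dest: inj_onD)
    then show "v = w"
      using tvec_of_coordinates[of v c] tvec_of_coordinates[of w c] vw assms(1) by simp
  qed
  have mem: "tvec_of M c p \<xi> \<in> ?S"
    using assms tvec_of_tangent by simp
  have "tangent_chart c (tvec_of M c p \<xi>) = (snd c p, \<xi>)"
    using assms by (simp add: tangent_chart_def snd_tvec_of)
  then show ?thesis
    using inv_into_f_f[OF inj mem] by (simp add: local_rep_def)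
qed

lemma tscale_tvec_of:
  assumes "c \<in> atlas M" "p \<in> fst c"
  shows "tscale t (tvec_of M c p \<xi>) = tvec_of M c p (t *\<^sub>R \<xi>)"
proof -
  have "transition c d p (t *\<^sub>R \<xi>) = t *\<^sub>R transition c d p \<xi>" if "d \<in> atlas M" "p \<in> fst d" for d
    by (rule linear_simps(5)[OF transition_linear[OF assms(1) that(1) assms(2) that(2)]])
  then show ?thesis by (simp add: tscale_def tvec_of_def fun_eq_iff del: split_paired_All)
qed

lemma tvec_of_slit:
  assumes "c \<in> atlas M" "p \<in> fst c"
  shows "tvec_of M c p \<xi> \<in> slit_tangent_bundle M \<longleftrightarrow> \<xi> \<noteq> 0"
proof -
  have "snd (tvec_of M c p 0) = (\<lambda>d. 0)"
    by (simp add: tvec_of_def fun_eq_iff linear_simps(3)[OF transition_linear[OF assms(1) _ assms(2)]]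
        del: split_paired_All)
  moreover have "\<xi> = 0" if "snd (tvec_of M c p \<xi>) = (\<lambda>d. 0)"
    using snd_tvec_of[OF assms, of \<xi>] that by simp
  ultimately show ?thesis
    using tvec_of_tangent[OF assms] by (auto simp: slit_tangent_bundle_def)
qed

lemma tangent_map_chart:
  assumes "c \<in> atlas M" "p \<in> fst c"
    and "\<And>e d. \<lbrakk>e \<in> atlas M; p \<in> fst e; d \<in> atlas N; f p \<in> fst d\<rbrakk> \<Longrightarrow>
      (snd d \<circ> f \<circ> chart_inv e) differentiable (at (snd e p))"
  shows "tangent_map M N f (tvec_of M c p \<xi>) = (f p, \<lambda>d. if d \<in> atlas N \<and> f p \<in> fst d
     then frechet_derivative (snd d \<circ> f \<circ> chart_inv c) (at (snd c p)) \<xi> else 0)"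
proof -
  \<comment> \<open>The arbitrary chart chosen inside \<open>tangent_map\<close>; the chain rule
    carries the differential from it to \<open>c\<close>.\<close>
  define e where "e = (SOME e. e \<in> atlas M \<and> p \<in> fst e)"
  have e: "e \<in> atlas M" "p \<in> fst e"
    unfolding e_def using someI_ex[of "\<lambda>e. e \<in> atlas M \<and> p \<in> fst e"] assms(1,2) by blast+
  have "frechet_derivative (snd d \<circ> f \<circ> chart_inv e) (at (snd e p)) (transition c e p \<xi>)
      = frechet_derivative (snd d \<circ> f \<circ> chart_inv c) (at (snd c p)) \<xi>"
    if "d \<in> atlas N" "f p \<in> fst d" for d
  proof -
    have "(snd d \<circ> f \<circ> chart_inv e has_derivative
        frechet_derivative (snd d \<circ> f \<circ> chart_inv e) (at (snd e p))) (at (snd e p))"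
      using assms(3)[OF e that] frechet_derivative_works by blast
    from frechet_derivative_at[OF chart_change[OF assms(1) e(1) assms(2) e(2) this]]
    show ?thesis by (metis comp_apply)
  qed
  then show ?thesis
    using e by (simp add: tangent_map_def Let_def tvec_of_def fun_eq_iff del: split_paired_All flip: e_def)
qed

end

lemma charted_smooth_manifold:
  assumes "smooth_manifold M" shows "charted_manifold M"
proof unfold_locales
  fix c assume c: "c \<in> atlas M"
  have hom: "homeomorphic_map (subtopology (mtop M) (fst c)) (top_of_set (snd c ` fst c)) (snd c)"
    and op: "openin (mtop M) (fst c)" "open (snd c ` fst c)"
    using assms c by (auto simp: smooth_manifold_def)
  show sub: "fst c \<subseteq> topspace (mtop M)" using op(1) by (rule openin_subset)
  then have top: "topspace (subtopology (mtop M) (fst c)) = fst c" by auto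
  show "inj_on (snd c) (fst c)"
    using homeomorphic_imp_injective_map[OF hom] unfolding top .
  fix d assume d: "d \<in> atlas M"
  then have "openin (mtop M) (fst d)" using assms by (auto simp: smooth_manifold_def)
  then have "openin (subtopology (mtop M) (fst c)) (fst c \<inter> fst d)"
    by (simp add: openin_subtopology_Int2)
  then have "openin (top_of_set (snd c ` fst c)) (snd c ` (fst c \<inter> fst d))"
    using homeomorphic_imp_open_map[OF hom] unfolding open_map_def by blast
  then show open_im: "open (snd c ` (fst c \<inter> fst d))"
    using op(2) openin_open_eq by blast
  fix p assume "p \<in> fst c" "p \<in> fst d"
  moreover have "smooth_on (snd c ` (fst c \<inter> fst d)) (snd d \<circ> chart_inv c)"
    using assms c d by (auto simp: smooth_manifold_def)
  ultimately show "(snd d \<circ> chart_inv c) differentiable (at (snd c p))"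
    using smooth_on_has_derivative differentiable_def by blast
qed

section \<open>Products\<close>

interpretation sum_index: splitting Inl Inr
proof unfold_locales
  show "(\<exists>i. k = Inl i) \<or> (\<exists>a. k = Inr a)" for k :: "'a + 'b" by (cases k) auto
qed simp_all

lemma fst_prod_chart [simp]: "fst (prod_chart c d) = fst c \<times> fst d"
  by (simp add: prod_chart_def)

lemma snd_prod_chart [simp]: "snd (prod_chart c d) (p, q) = sum_index.join (snd c p) (snd d q)"
  by (simp add: prod_chart_def sum_index.vec_eq_split)

locale manifold_pair = M1: charted_manifold M1 + M2: charted_manifold M2
  for M1 :: "('a, 'n::finite) manifold" and M2 :: "('b, 'm::finite) manifold"
begin

lemma prod_chart_image:
  "snd (prod_chart c d) ` (S \<times> T) = {z. sum_index.proj1 z \<in> snd c ` S \<and> sum_index.proj2 z \<in> snd d ` T}"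
proof (intro set_eqI iffI)
  fix z assume "z \<in> {z. sum_index.proj1 z \<in> snd c ` S \<and> sum_index.proj2 z \<in> snd d ` T}"
  then obtain p q where pq: "p \<in> S" "q \<in> T" "sum_index.proj1 z = snd c p" "sum_index.proj2 z = snd d q"
    by auto
  then have "z = snd (prod_chart c d) (p, q)"
    using sum_index.join_proj[of z] by simp
  then show "z \<in> snd (prod_chart c d) ` (S \<times> T)" using pq(1,2) by blast
qed auto

lemma inj_prod_chart:
  assumes "c \<in> atlas M1" "d \<in> atlas M2"
  shows "inj_on (snd (prod_chart c d)) (fst c \<times> fst d)"
proof (rule inj_onI)
  fix w w' assume w: "w \<in> fst c \<times> fst d" "w' \<in> fst c \<times> fst d"
    "snd (prod_chart c d) w = snd (prod_chart c d) w'"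
  obtain p q p' q' where pq: "w = (p, q)" "w' = (p', q')" by fastforce
  have "snd c p = snd c p'" "snd d q = snd d q'"
    using w(3) unfolding pq snd_prod_chart by (metis sum_index.proj_join)+
  then show "w = w'"
    using w(1,2) M1.inj_chart[OF assms(1)] M2.inj_chart[OF assms(2)] unfolding pq
    by (auto dest: inj_onD)
qed

lemma open_prod_chart_image:
  assumes "open (snd c ` S)" "open (snd d ` T)"
  shows "open (snd (prod_chart c d) ` (S \<times> T))"
proof -
  have "continuous_on UNIV sum_index.proj1" "continuous_on UNIV sum_index.proj2"
    by (intro linear_continuous_on sum_index.bounded_linear_proj)+
  then have "open (sum_index.proj1 -` (snd c ` S) \<inter> sum_index.proj2 -` (snd d ` T))"
    using assms by (intro open_Int open_vimage)
  moreover have "snd (prod_chart c d) ` (S \<times> T) = sum_index.proj1 -` (snd c ` S) \<inter> sum_index.proj2 -` (snd d ` T)"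
    unfolding prod_chart_image by auto
  ultimately show ?thesis by simp
qed

lemma chart_inv_prod_chart:
  assumes "c \<in> atlas M1" "d \<in> atlas M2" "z \<in> snd (prod_chart c d) ` (fst c \<times> fst d)"
  shows "inv_into (fst c \<times> fst d) (snd (prod_chart c d)) z = (chart_inv c (sum_index.proj1 z), chart_inv d (sum_index.proj2 z))"
proof -
  obtain p q where pq: "p \<in> fst c" "q \<in> fst d" "z = snd (prod_chart c d) (p, q)"
    using assms(3) by auto
  then have "inv_into (fst c \<times> fst d) (snd (prod_chart c d)) z = (p, q)"
    using inv_into_f_f[OF inj_prod_chart[OF assms(1,2)], of "(p, q)"] by simp
  then show ?thesis using pq assms(1,2) by simp
qed

text \<open>In product coordinates the first component depends on \<open>proj1\<close> alone,
  through a transition of the first factor. This holds on the open image of the product chart, which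
  determines the derivative.\<close>

lemma chart_fst_has_derivative:
  assumes "c \<in> atlas M1" "d \<in> atlas M2" "p \<in> fst c" "q \<in> fst d" "c' \<in> atlas M1" "p \<in> fst c'"
  shows "((\<lambda>z. snd c' (fst (chart_inv (prod_chart c d) z))) has_derivative
    (\<lambda>h. M1.transition c c' p (sum_index.proj1 h))) (at (sum_index.join (snd c p) (snd d q)))"
proof (rule has_derivative_transform_within_open)
  show "((\<lambda>z. (snd c' \<circ> chart_inv c) (sum_index.proj1 z)) has_derivative
    (\<lambda>h. M1.transition c c' p (sum_index.proj1 h))) (at (sum_index.join (snd c p) (snd d q)))"
    by (rule has_derivative_compose[OF bounded_linear_imp_has_derivative[OF sum_index.bounded_linear_proj(1)]])
      (simp only: sum_index.proj_join M1.transition_has_derivative assms)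
  show "open (snd (prod_chart c d) ` (fst c \<times> fst d))"
    using M1.open_overlap[of c c] M2.open_overlap[of d d] assms by (intro open_prod_chart_image) auto
  show "sum_index.join (snd c p) (snd d q) \<in> snd (prod_chart c d) ` (fst c \<times> fst d)"
    using assms by (intro image_eqI[of _ _ "(p, q)"]) auto
qed (simp add: chart_inv_prod_chart assms(1,2))

lemma chart_snd_has_derivative:
  assumes "c \<in> atlas M1" "d \<in> atlas M2" "p \<in> fst c" "q \<in> fst d" "d' \<in> atlas M2" "q \<in> fst d'"
  shows "((\<lambda>z. snd d' (snd (chart_inv (prod_chart c d) z))) has_derivative
    (\<lambda>h. M2.transition d d' q (sum_index.proj2 h))) (at (sum_index.join (snd c p) (snd d q)))"
proof (rule has_derivative_transform_within_open)
  show "((\<lambda>z. (snd d' \<circ> chart_inv d) (sum_index.proj2 z)) has_derivative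
    (\<lambda>h. M2.transition d d' q (sum_index.proj2 h))) (at (sum_index.join (snd c p) (snd d q)))"
    by (rule has_derivative_compose[OF bounded_linear_imp_has_derivative[OF sum_index.bounded_linear_proj(2)]])
      (simp only: sum_index.proj_join M2.transition_has_derivative assms)
  show "open (snd (prod_chart c d) ` (fst c \<times> fst d))"
    using M1.open_overlap[of c c] M2.open_overlap[of d d] assms by (intro open_prod_chart_image) auto
  show "sum_index.join (snd c p) (snd d q) \<in> snd (prod_chart c d) ` (fst c \<times> fst d)"
    using assms by (intro image_eqI[of _ _ "(p, q)"]) auto
qed (simp add: chart_inv_prod_chart assms(1,2))

lemma atlas_prod: "atlas (prod_manifold M1 M2) = {prod_chart c d |c d. c \<in> atlas M1 \<and> d \<in> atlas M2}"
  by (simp add: prod_manifold_def)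

lemma prod_chart_atlas:
  "c \<in> atlas M1 \<Longrightarrow> d \<in> atlas M2 \<Longrightarrow> prod_chart c d \<in> atlas (prod_manifold M1 M2)"
  unfolding atlas_prod by blast

sublocale P: charted_manifold "prod_manifold M1 M2"
proof unfold_locales
  fix e assume "e \<in> atlas (prod_manifold M1 M2)"
  then obtain c d where e: "e = prod_chart c d" "c \<in> atlas M1" "d \<in> atlas M2"
    by (auto simp: atlas_prod)
  show "inj_on (snd e) (fst e)" using inj_prod_chart[OF e(2,3)] by (simp add: e(1))
  show "fst e \<subseteq> topspace (mtop (prod_manifold M1 M2))"
    using M1.chart_subset[OF e(2)] M2.chart_subset[OF e(3)] by (auto simp: e(1) prod_manifold_def)
  fix e' assume "e' \<in> atlas (prod_manifold M1 M2)"
  then obtain c' d' where e': "e' = prod_chart c' d'" "c' \<in> atlas M1" "d' \<in> atlas M2"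
    by (auto simp: atlas_prod)
  show "open (snd e ` (fst e \<inter> fst e'))"
    using open_prod_chart_image[OF M1.open_overlap[OF e(2) e'(2)] M2.open_overlap[OF e(3) e'(3)]]
    by (simp add: e(1) e'(1) Times_Int_Times)
  fix w assume w: "w \<in> fst e" "w \<in> fst e'"
  obtain p q where pq: "w = (p, q)" by fastforce
  have "snd e' \<circ> chart_inv e = (\<lambda>z. sum_index.join (snd c' (fst (chart_inv (prod_chart c d) z)))
      (snd d' (snd (chart_inv (prod_chart c d) z))))"
    by (rule ext) (metis comp_apply e(1) e'(1) prod.collapse snd_prod_chart)
  moreover have "(\<dots> has_derivative (\<lambda>h. sum_index.join (M1.transition c c' p (sum_index.proj1 h))
      (M2.transition d d' q (sum_index.proj2 h)))) (at (snd e w))"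
    unfolding e(1) pq snd_prod_chart
    by (intro sum_index.has_derivative_join chart_fst_has_derivative chart_snd_has_derivative)
      (use w e e' pq in auto)
  ultimately show "(snd e' \<circ> chart_inv e) differentiable (at (snd e w))"
    by (auto simp: differentiable_def)
qed

section \<open>Tangent vectors and the metric of the product\<close>

lemma tangent_fst_tvec_of:
  assumes "c \<in> atlas M1" "d \<in> atlas M2" "p \<in> fst c" "q \<in> fst d"
  shows "tangent_fst M1 M2 (tvec_of (prod_manifold M1 M2) (prod_chart c d) (p, q) \<xi>)
    = tvec_of M1 c p (sum_index.proj1 \<xi>)"
proof -
  have "tangent_fst M1 M2 (tvec_of (prod_manifold M1 M2) (prod_chart c d) (p, q) \<xi>)
    = (fst (p, q), \<lambda>c'. if c' \<in> atlas M1 \<and> fst (p, q) \<in> fst c' then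
        frechet_derivative (snd c' \<circ> fst \<circ> chart_inv (prod_chart c d)) (at (snd (prod_chart c d) (p, q))) \<xi> else 0)"
    unfolding tangent_fst_def
  proof (rule P.tangent_map_chart)
    fix e c' assume "e \<in> atlas (prod_manifold M1 M2)" "(p, q) \<in> fst e" "c' \<in> atlas M1" "fst (p, q) \<in> fst c'"
    moreover from this obtain c0 d0 where e: "e = prod_chart c0 d0" "c0 \<in> atlas M1" "d0 \<in> atlas M2"
      by (auto simp: atlas_prod)
    ultimately have "p \<in> fst c0" "q \<in> fst d0" "c' \<in> atlas M1" "fst (p, q) \<in> fst c'" by auto
    from chart_fst_has_derivative[OF e(2,3) this(1,2,3) this(4)[simplified]]
    show "(snd c' \<circ> fst \<circ> chart_inv e) differentiable (at (snd e (p, q)))"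
      unfolding e(1) snd_prod_chart comp_def differentiable_def by blast
  qed (use assms prod_chart_atlas in auto)
  moreover have "frechet_derivative (snd c' \<circ> fst \<circ> chart_inv (prod_chart c d))
      (at (snd (prod_chart c d) (p, q))) \<xi> = M1.transition c c' p (sum_index.proj1 \<xi>)"
    if "c' \<in> atlas M1" "p \<in> fst c'" for c'
    using fun_cong[OF frechet_derivative_at[OF chart_fst_has_derivative[OF assms that]], of \<xi>]
    unfolding comp_def snd_prod_chart by simp
  ultimately show ?thesis by (simp add: tvec_of_def fun_eq_iff del: split_paired_All)
qed

lemma tangent_snd_tvec_of:
  assumes "c \<in> atlas M1" "d \<in> atlas M2" "p \<in> fst c" "q \<in> fst d"
  shows "tangent_snd M1 M2 (tvec_of (prod_manifold M1 M2) (prod_chart c d) (p, q) \<xi>)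
    = tvec_of M2 d q (sum_index.proj2 \<xi>)"
proof -
  have "tangent_snd M1 M2 (tvec_of (prod_manifold M1 M2) (prod_chart c d) (p, q) \<xi>)
    = (snd (p, q), \<lambda>d'. if d' \<in> atlas M2 \<and> snd (p, q) \<in> fst d' then
        frechet_derivative (snd d' \<circ> snd \<circ> chart_inv (prod_chart c d)) (at (snd (prod_chart c d) (p, q))) \<xi> else 0)"
    unfolding tangent_snd_def
  proof (rule P.tangent_map_chart)
    fix e d' assume "e \<in> atlas (prod_manifold M1 M2)" "(p, q) \<in> fst e" "d' \<in> atlas M2" "snd (p, q) \<in> fst d'"
    moreover from this obtain c0 d0 where e: "e = prod_chart c0 d0" "c0 \<in> atlas M1" "d0 \<in> atlas M2"
      by (auto simp: atlas_prod)
    ultimately have "p \<in> fst c0" "q \<in> fst d0" "d' \<in> atlas M2" "snd (p, q) \<in> fst d'" by auto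
    from chart_snd_has_derivative[OF e(2,3) this(1,2,3) this(4)[simplified]]
    show "(snd d' \<circ> snd \<circ> chart_inv e) differentiable (at (snd e (p, q)))"
      unfolding e(1) snd_prod_chart comp_def differentiable_def by blast
  qed (use assms prod_chart_atlas in auto)
  moreover have "frechet_derivative (snd d' \<circ> snd \<circ> chart_inv (prod_chart c d))
      (at (snd (prod_chart c d) (p, q))) \<xi> = M2.transition d d' q (sum_index.proj2 \<xi>)"
    if "d' \<in> atlas M2" "q \<in> fst d'" for d'
    using fun_cong[OF frechet_derivative_at[OF chart_snd_has_derivative[OF assms that]], of \<xi>]
    unfolding comp_def snd_prod_chart by simp
  ultimately show ?thesis by (simp add: tvec_of_def fun_eq_iff del: split_paired_All)
qed

lemma tvec_of_bislit:
  assumes "c \<in> atlas M1" "d \<in> atlas M2" "p \<in> fst c" "q \<in> fst d"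
  shows "tvec_of (prod_manifold M1 M2) (prod_chart c d) (p, q) (sum_index.join y v) \<in> bislit_bundle M1 M2
    \<longleftrightarrow> y \<noteq> 0 \<and> v \<noteq> 0"
  using assms P.tvec_of_tangent[OF prod_chart_atlas[OF assms(1,2)], of "(p, q)"]
  by (simp add: bislit_bundle_def tangent_fst_tvec_of tangent_snd_tvec_of
      M1.tvec_of_slit M2.tvec_of_slit)

lemma local_rep_dwp:
  assumes "c \<in> atlas M1" "d \<in> atlas M2" "p \<in> fst c" "q \<in> fst d"
  shows "local_rep (prod_manifold M1 M2) (dwp_metric M1 F1 f1 M2 F2 f2) (prod_chart c d)
      (sum_index.join (snd c p) (snd d q)) (sum_index.join y v)
    = sqrt ((f2 q)\<^sup>2 * (local_rep M1 F1 c (snd c p) y)\<^sup>2 + (f1 p)\<^sup>2 * (local_rep M2 F2 d (snd d q) v)\<^sup>2)"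
proof -
  have "local_rep (prod_manifold M1 M2) (dwp_metric M1 F1 f1 M2 F2 f2) (prod_chart c d)
      (sum_index.join (snd c p) (snd d q)) (sum_index.join y v) =
    dwp_metric M1 F1 f1 M2 F2 f2 (tvec_of (prod_manifold M1 M2) (prod_chart c d) (p, q) (sum_index.join y v))"
    using P.local_rep_chart[OF prod_chart_atlas[OF assms(1,2)], of "(p, q)"] assms by simp
  then show ?thesis
    using assms by (simp add: dwp_metric_def tangent_fst_tvec_of tangent_snd_tvec_of
        M1.local_rep_chart M2.local_rep_chart Let_def)
qed

end

section \<open>Doubly warped products with vanishing Douglas curvature\<close>

lemma finsler_local_rep:
  assumes "finsler_manifold M F" "c \<in> atlas M"
  shows "finsler_local (snd c ` fst c) (local_rep M F c)"
proof -
  have M: "smooth_manifold M" and F: "finsler_metric M F"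
    using assms(1) by (auto simp: finsler_manifold_def)
  interpret charted_manifold M by (rule charted_smooth_manifold[OF M])
  show ?thesis
  proof
    show "open (snd c ` fst c)" using open_overlap[OF assms(2) assms(2)] by simp
    show "smooth_on (snd c ` fst c \<times> (UNIV - {0})) (\<lambda>(x, y). local_rep M F c x y)"
      using F assms(2) by (simp add: finsler_metric_def)
    show "(\<Sum>i\<in>UNIV. \<Sum>j\<in>UNIV. fund_tensor (local_rep M F c) i j x y * w $ i * w $ j) > 0"
      if "x \<in> snd c ` fst c" "y \<noteq> 0" "w \<noteq> 0" for x y w
      using F assms(2) that unfolding finsler_metric_def by blast
    fix x y and t :: real assume "x \<in> snd c ` fst c" "t > 0"
    then obtain p where p: "p \<in> fst c" "x = snd c p" by auto
    have "F (tscale t (tvec_of M c p y)) = t * F (tvec_of M c p y)"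
      using F tvec_of_tangent[OF assms(2) p(1)] \<open>t > 0\<close> unfolding finsler_metric_def by blast
    then show "local_rep M F c x (t *\<^sub>R y) = t * local_rep M F c x y"
      by (simp add: p local_rep_chart[OF assms(2)] tscale_tvec_of[OF assms(2)])
  qed
qed

section \<open>Points where a warping function has nonzero differential\<close>

lemma connected_space_locally_constant:
  assumes "connected_space X"
    and "\<And>p. p \<in> topspace X \<Longrightarrow> \<exists>N. openin X N \<and> p \<in> N \<and> (\<forall>q\<in>N. g q = g p)"
  shows "g constant_on topspace X"
proof (cases "topspace X = {}")
  case False
  then obtain p0 where p0: "p0 \<in> topspace X" by blast
  define E where "E = {p \<in> topspace X. g p = g p0}"
  \<comment> \<open>Every preimage is open. Those of \<open>{g p0}\<close> and its complement
    partition the space into two open sets, and the one without \<open>p0\<close> must be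
    empty.\<close>
  have "openin X {p \<in> topspace X. g p \<in> S}" for S
  proof (subst openin_subopen, intro ballI)
    fix p assume p: "p \<in> {p \<in> topspace X. g p \<in> S}"
    with assms(2)[of p] obtain N where N: "openin X N" "p \<in> N" "\<forall>q\<in>N. g q = g p"
      by blast
    have "q \<in> {p \<in> topspace X. g p \<in> S}" if "q \<in> N" for q
    proof -
      have "g q = g p" using N(3) that by blast
      then show ?thesis using p openin_subset[OF N(1)] that by auto
    qed
    with N show "\<exists>T. openin X T \<and> p \<in> T \<and> T \<subseteq> {p \<in> topspace X. g p \<in> S}" by blast
  qed
  from this[of "{g p0}"] this[of "- {g p0}"]
  have "openin X E" "openin X (topspace X - E)"
    by (simp_all add: E_def set_diff_eq cong: conj_cong)
  moreover have "topspace X \<subseteq> E \<union> (topspace X - E)" "E \<inter> (topspace X - E) = {}" by auto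
  moreover have "E \<noteq> {}" using p0 by (auto simp: E_def)
  ultimately have "topspace X - E = {}"
    using assms(1) unfolding connected_space_def by blast
  then show ?thesis by (auto simp: constant_on_def E_def)
qed (simp add: constant_on_def)

text \<open>If all these derivatives vanished, \<open>f^2\<close> would be constant on coordinate
  balls, hence globally by connectedness, and the positive \<open>f\<close> with it. The square
  appears because it serves as \<open>q1\<close> or \<open>q2\<close> in the local
  computation.\<close>

lemma ex_pd_nonzero:
  assumes M: "smooth_manifold M" "connected_space (mtop M)" and f: "warping_function M f"
    and "\<not> f constant_on topspace (mtop M)"
  obtains c p l where "c \<in> atlas M" "p \<in> fst c" "pd l (\<lambda>x. (f (chart_inv c x))\<^sup>2) (snd c p) \<noteq> 0"
proof (rule ccontr)
  interpret charted_manifold M by (rule charted_smooth_manifold[OF M(1)])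
  assume "\<not> thesis"
  with that have 0: "\<And>c p l. \<lbrakk>c \<in> atlas M; p \<in> fst c\<rbrakk> \<Longrightarrow> pd l (\<lambda>x. (f (chart_inv c x))\<^sup>2) (snd c p) = 0"
    by blast
  have "(\<lambda>p. (f p)\<^sup>2) constant_on topspace (mtop M)"
  proof (rule connected_space_locally_constant[OF M(2)])
    fix p assume "p \<in> topspace (mtop M)"
    then have "p \<in> \<Union> (fst ` atlas M)" using M(1) by (simp add: smooth_manifold_def)
    then obtain c where c: "c \<in> atlas M" "p \<in> fst c" by blast
    let ?U = "snd c ` fst c" and ?g = "\<lambda>x. (f (chart_inv c x))\<^sup>2"
    have U: "open ?U" using open_overlap[OF c(1) c(1)] by simp
    then obtain e where e: "e > 0" "ball (snd c p) e \<subseteq> ?U"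
      using c(2) openE by blast
    have smooth: "smooth_on ?U ?g"
      using f c(1) smooth_on_power2[OF U] by (simp add: warping_function_def smooth_function_def comp_def)
    have g: "(?g has_derivative (\<lambda>h. 0)) (at x)" if "x \<in> ?U" for x
    proof -
      let ?g' = "frechet_derivative ?g (at x)"
      have D: "(?g has_derivative ?g') (at x)"
        using smooth_on_has_derivative[OF smooth that] .
      interpret g': bounded_linear ?g' using D by (rule has_derivative_bounded_linear)
      have axis: "?g' (axis l 1) = 0" for l
        using 0[OF c(1)] that pd_frechet[OF smooth that, of l] by auto
      have "?g' h = 0" for h
      proof -
        have "?g' h = ?g' (\<Sum>l\<in>UNIV. h $ l *\<^sub>R axis l 1)"
          by (simp add: basis_expansion flip: scalar_mult_eq_scaleR)
        then show ?thesis by (simp add: g'.sum g'.scaleR axis)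
      qed
      then have "?g' = (\<lambda>h. 0)" by blast
      with D show ?thesis by simp
    qed
    have const: "?g x = ?g (snd c p)" if "x \<in> ball (snd c p) e" for x
      by (rule has_derivative_zero_unique[OF convex_ball has_derivative_at_withinI[OF g] that])
        (use e in auto)
    define N where "N = {q \<in> fst c. snd c q \<in> ball (snd c p) e}"
    have c_open: "openin (mtop M) (fst c)"
      and hom: "homeomorphic_map (subtopology (mtop M) (fst c)) (top_of_set ?U) (snd c)"
      using M(1) c(1) by (auto simp: smooth_manifold_def)
    have "openin (subtopology (mtop M) (fst c))
        {q \<in> topspace (subtopology (mtop M) (fst c)). snd c q \<in> ball (snd c p) e}"
      using homeomorphic_imp_continuous_map[OF hom] e(2)
      by (intro openin_continuous_map_preimage[where Y = "top_of_set ?U"]) (auto simp: openin_open_eq[OF U])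
    moreover have top: "topspace (subtopology (mtop M) (fst c)) = fst c"
      using chart_subset[OF c(1)] by auto
    ultimately have "openin (mtop M) N"
      using openin_trans_full[OF _ c_open] unfolding N_def top by blast
    moreover have "(f q)\<^sup>2 = (f p)\<^sup>2" if "q \<in> N" for q
      using const[of "snd c q"] that c by (simp add: N_def)
    moreover have "p \<in> N" using c(2) e(1) by (simp add: N_def)
    ultimately show "\<exists>N. openin (mtop M) N \<and> p \<in> N \<and> (\<forall>q\<in>N. (f q)\<^sup>2 = (f p)\<^sup>2)"
      by blast
  qed
  then obtain k where k: "\<And>p. p \<in> topspace (mtop M) \<Longrightarrow> (f p)\<^sup>2 = k"
    by (auto simp: constant_on_def)
  have "f p = sqrt k" if "p \<in> topspace (mtop M)" for p
    using f that by (simp add: warping_function_def order_less_imp_le flip: k[OF that])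
  then show False using assms(4) by (auto simp: constant_on_def)
qed

section \<open>Transfer of the local computation to the product manifold\<close>

context manifold_pair
begin

text \<open>The argument of the root in the metric is nonnegative, so squaring removes the root and
  gives \<open>L_join\<close> with the squared warping functions.\<close>

lemma dwp_local_charts:
  assumes "finsler_manifold M1 F1" "finsler_manifold M2 F2"
    and "warping_function M1 f1" "warping_function M2 f2"
    and "c \<in> atlas M1" "d \<in> atlas M2"
  shows "dwp_local Inl Inr (snd c ` fst c) (local_rep M1 F1 c) (snd d ` fst d) (local_rep M2 F2 d)
    (\<lambda>x. (f1 (chart_inv c x))\<^sup>2) (\<lambda>u. (f2 (chart_inv d u))\<^sup>2)
    (local_rep (prod_manifold M1 M2) (dwp_metric M1 F1 f1 M2 F2 f2) (prod_chart c d))"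
proof -
  interpret L1: finsler_local "snd c ` fst c" "local_rep M1 F1 c"
    by (rule finsler_local_rep[OF assms(1,5)])
  interpret L2: finsler_local "snd d ` fst d" "local_rep M2 F2 d"
    by (rule finsler_local_rep[OF assms(2,6)])
  have pos: "p \<in> fst c \<Longrightarrow> f1 p > 0" "q \<in> fst d \<Longrightarrow> f2 q > 0" for p q
    using assms(3,4) M1.chart_subset[OF assms(5)] M2.chart_subset[OF assms(6)]
    unfolding warping_function_def by blast+
  show ?thesis
  proof
    show "smooth_on (snd c ` fst c) (\<lambda>x. (f1 (chart_inv c x))\<^sup>2)"
      using assms(3,5) smooth_on_power2[OF L1.open_U]
      by (simp add: warping_function_def smooth_function_def comp_def)
    show "smooth_on (snd d ` fst d) (\<lambda>u. (f2 (chart_inv d u))\<^sup>2)"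
      using assms(4,6) smooth_on_power2[OF L2.open_U]
      by (simp add: warping_function_def smooth_function_def comp_def)
    show "(f1 (chart_inv c x))\<^sup>2 > 0" if "x \<in> snd c ` fst c" for x
      using pos(1) that assms(5) by fastforce
    show "(f2 (chart_inv d u))\<^sup>2 > 0" if "u \<in> snd d ` fst d" for u
      using pos(2) that assms(6) by fastforce
    fix x u y v assume "x \<in> snd c ` fst c" "u \<in> snd d ` fst d"
    then obtain p q where "p \<in> fst c" "x = snd c p" "q \<in> fst d" "u = snd d q" by auto
    then show "(local_rep (prod_manifold M1 M2) (dwp_metric M1 F1 f1 M2 F2 f2) (prod_chart c d)
        (sum_index.join x u) (sum_index.join y v))\<^sup>2
      = (f2 (chart_inv d u))\<^sup>2 * (local_rep M1 F1 c x y)\<^sup>2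
        + (f1 (chart_inv c x))\<^sup>2 * (local_rep M2 F2 d u v)\<^sup>2"
      using assms(5,6) by (simp add: local_rep_dwp)
  qed
qed

text \<open>All pairs of nonzero \<open>y\<close> and \<open>v\<close> are coordinates of vectors in
  the bislit bundle; this gives the freedom to rescale \<open>y\<close> in the local
  argument.\<close>

lemma douglas_vanishes_charts:
  assumes "douglas_vanishes (prod_manifold M1 M2) (bislit_bundle M1 M2) F"
    and "c \<in> atlas M1" "d \<in> atlas M2" "p \<in> fst c" "q \<in> fst d" "y \<noteq> 0" "v \<noteq> 0"
  shows "douglas (local_rep (prod_manifold M1 M2) F (prod_chart c d)) i j k l
    (sum_index.join (snd c p) (snd d q)) (sum_index.join y v) = 0"
proof -
  let ?w = "tvec_of (prod_manifold M1 M2) (prod_chart c d) (p, q) (sum_index.join y v)"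
  have e: "prod_chart c d \<in> atlas (prod_manifold M1 M2)"
    using assms(2,3) by (rule prod_chart_atlas)
  moreover have "?w \<in> bislit_bundle M1 M2" using assms by (simp add: tvec_of_bislit)
  moreover have "fst ?w \<in> fst (prod_chart c d)" using assms by simp
  ultimately have "douglas (local_rep (prod_manifold M1 M2) F (prod_chart c d)) i j k l
      (snd (prod_chart c d) (fst ?w)) (snd ?w (prod_chart c d)) = 0"
    using assms(1) unfolding douglas_vanishes_def by blast
  then show ?thesis using P.snd_tvec_of[OF e, of "(p, q)"] assms(4,5) by simp
qed

end

theorem theorem4:
  fixes M1 :: "('a, 'n::finite) manifold" and M2 :: "('b, 'm::finite) manifold"
    and F1 :: "('a, 'n) tvec \<Rightarrow> real" and F2 :: "('b, 'm) tvec \<Rightarrow> real"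
    and f1 :: "'a \<Rightarrow> real" and f2 :: "'b \<Rightarrow> real"
  assumes "finsler_manifold M1 F1" and "finsler_manifold M2 F2"
    and "connected_space (mtop M1)" and "connected_space (mtop M2)"
    and "warping_function M1 f1" and "warping_function M2 f2"
    and proper: "\<not> f1 constant_on topspace (mtop M1)" "\<not> f2 constant_on topspace (mtop M2)"
    and "douglas_vanishes (prod_manifold M1 M2) (bislit_bundle M1 M2)
           (dwp_metric M1 F1 f1 M2 F2 f2)"
  shows "riemannian (prod_manifold M1 M2) (bislit_bundle M1 M2) (dwp_metric M1 F1 f1 M2 F2 f2)"
proof -
  have M: "smooth_manifold M1" "smooth_manifold M2"
    using assms(1,2) by (simp_all add: finsler_manifold_def)
  interpret manifold_pair M1 M2
    by (intro manifold_pair.intro charted_smooth_manifold M)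
  note local = dwp_local_charts[OF assms(1,2,5,6)]
    and douglas = douglas_vanishes_charts[OF assms(9)]
  let ?H1 = "\<lambda>c p y. (local_rep M1 F1 c (snd c p) y)\<^sup>2" and ?H2 = "\<lambda>d q v. (local_rep M2 F2 d (snd d q) v)\<^sup>2"
  \<comment> \<open>The point \<open>p\<close> is arbitrary, while \<open>q\<close> is picked where
    \<open>f2^2\<close> has a nonzero partial derivative; the local result is applied with the
    factors exchanged.\<close>
  have H1: "pd i (pd j (pd k (?H1 c p))) y = 0" if c: "c \<in> atlas M1" "p \<in> fst c" and y: "y \<noteq> 0" for c p y i j k
  proof -
    obtain d q l where d: "d \<in> atlas M2" "q \<in> fst d" "pd l (\<lambda>u. (f2 (chart_inv d u))\<^sup>2) (snd d q) \<noteq> 0"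
      by (rule ex_pd_nonzero[OF M(2) assms(4,6) proper(2)])
    interpret dwp_local Inl Inr "snd c ` fst c" "local_rep M1 F1 c" "snd d ` fst d" "local_rep M2 F2 d"
      "\<lambda>x. (f1 (chart_inv c x))\<^sup>2" "\<lambda>u. (f2 (chart_inv d u))\<^sup>2"
      "local_rep (prod_manifold M1 M2) (dwp_metric M1 F1 f1 M2 F2 f2) (prod_chart c d)"
      by (rule local[OF c(1) d(1)])
    show ?thesis
      by (rule dwp_local.third_derivative_eq_0[OF flip imageI[OF d(2)] imageI[OF c(2)] y d(3)])
        (simp add: sum_index.join_flip douglas c d(1,2) y)
  qed
  \<comment> \<open>Here the factors keep their order, and the auxiliary point lies in
    \<open>M1\<close>.\<close>
  have H2: "pd i (pd j (pd k (?H2 d q))) v = 0" if d: "d \<in> atlas M2" "q \<in> fst d" and v: "v \<noteq> 0" for d q v i j k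
  proof -
    obtain c p l where c: "c \<in> atlas M1" "p \<in> fst c" "pd l (\<lambda>x. (f1 (chart_inv c x))\<^sup>2) (snd c p) \<noteq> 0"
      by (rule ex_pd_nonzero[OF M(1) assms(3,5) proper(1)])
    show ?thesis
      by (rule dwp_local.third_derivative_eq_0[OF local[OF c(1) d(1)] imageI[OF c(2)] imageI[OF d(2)] v c(3)])
        (simp add: douglas c(1,2) d v)
  qed
  show ?thesis
    unfolding riemannian_def
  proof (intro ballI impI allI)
    fix e w and i j k :: "'n + 'm"
    assume e: "e \<in> atlas (prod_manifold M1 M2)" and w: "w \<in> bislit_bundle M1 M2" "fst w \<in> fst e"
    obtain c d where cd: "e = prod_chart c d" "c \<in> atlas M1" "d \<in> atlas M2"
      using e by (auto simp: atlas_prod)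
    obtain p q where pq: "fst w = (p, q)" "p \<in> fst c" "q \<in> fst d"
      using w(2) cd(1) by auto
    define y v where "y = sum_index.proj1 (snd w e)" and "v = sum_index.proj2 (snd w e)"
    have we: "snd w e = sum_index.join y v" by (simp add: y_def v_def)
    have "w = tvec_of (prod_manifold M1 M2) e (p, q) (sum_index.join y v)"
      using P.tvec_of_coordinates[OF _ e w(2)] w(1) pq(1) we by (simp add: bislit_bundle_def)
    \<comment> \<open>Membership in the bislit bundle makes both blocks nonzero, as the local lemmas
      require.\<close>
    then have yv: "y \<noteq> 0" "v \<noteq> 0"
      using w(1) tvec_of_bislit[OF cd(2,3) pq(2,3)] cd(1) by simp_all
    interpret dwp_local Inl Inr "snd c ` fst c" "local_rep M1 F1 c" "snd d ` fst d" "local_rep M2 F2 d"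
      "\<lambda>x. (f1 (chart_inv c x))\<^sup>2" "\<lambda>u. (f2 (chart_inv d u))\<^sup>2"
      "local_rep (prod_manifold M1 M2) (dwp_metric M1 F1 f1 M2 F2 f2) (prod_chart c d)"
      by (rule local[OF cd(2,3)])
    have "cartan_torsion (local_rep (prod_manifold M1 M2) (dwp_metric M1 F1 f1 M2 F2 f2) e) i j k
        (sum_index.join (snd c p) (snd d q)) (sum_index.join y v) = 0"
    \<comment> \<open>The local lemmas prescribe the block of the middle index only, so two cases
      suffice.\<close>
    proof (cases j)
      case (Inl j')
      then show ?thesis unfolding cd(1)
        using cartan_torsion_\<iota>[OF imageI[OF pq(2)] imageI[OF pq(3)] yv H1[OF cd(2) pq(2) yv(1)]] by simp
    next
      case (Inr j')
      then show ?thesis unfolding cd(1)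
        using cartan_torsion_\<kappa>[OF imageI[OF pq(2)] imageI[OF pq(3)] yv H2[OF cd(3) pq(3) yv(2)]] by simp
    qed
    then show "cartan_torsion (local_rep (prod_manifold M1 M2) (dwp_metric M1 F1 f1 M2 F2 f2) e) i j k
        (snd e (fst w)) (snd w e) = 0"
      unfolding we pq(1) by (simp add: cd(1))
  qed
qed

end
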